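(* Let $G=G^{(k_1,\ldots,k_m)}$ be a complex reflection group of reflection type $n_1C_{k_1},\ldots,n_mC_{k_m}$. Then the abelianisation map $G\to G_{\rm ab}=G/[G,G]$ maps reflections to reflections of the same order, with the $j$-th reflection orbit (of type $n_jC_{k_j}$) mapping onto the internal direct summand $C_{k_j}$ of $$G_{\rm ab}=\frac{G}{[G,G]}= C_{k_1}\times\cdots\times C_{k_m};$$ i.e., the abelianisation of $G^{(k_1,\ldots,k_m)}$ is $C_{k_1}\times\cdots\times C_{k_m}$. As a consequence, a generating set of reflections for $G$ must contain at least one reflection from each reflection orbit, and $[G,G]$ is a normal subgroup of $G$ which contains no reflections.
   Context: A reflection on $\mathbb{C}^d$ is an invertible linear map $g$ with $\mathrm{rank}(I-g)=1$; a complex reflection group is a finite group generated by reflections, taken to be unitary. For a root $a$ (nonzero vector orthogonal to the fixed hyperplane of a reflection in $G$), $R_a$ is the cyclic subgroup of $G$ consisting of the identity and all reflections with root line spanned by $a$. Let $R_{a_1}^G,\ldots,R_{a_m}^G$ be the distinct $G$-conjugation orbits of these subgroups (the reflection orbits), $k_j=|R_{a_j}|$ and $n_j$ the number of conjugates of $R_{a_j}$; one writes $G=G^{(k_1,\ldots,k_m)}$ and says $G$ has reflection type $n_1C_{k_1},\ldots,n_mC_{k_m}$. A reflection is said to be from (or in) the $j$-th orbit if it belongs to a conjugate of $R_{a_j}$. $C_n$ is the cyclic group of order $n$; the image group $C_{k_1}\times\cdots\times C_{k_m}$ is viewed as a reflection group on $\mathbb{C}^m$ via its natural diagonal action, so that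 nontrivial elements of a summand $C_{k_j}$ are reflections. *)

theory Defs
  imports
    "HOL-Algebra.Algebra"
    "Jordan_Normal_Form.Schur_Decomposition"
    "Jordan_Normal_Form.DL_Rank"
begin

definition GL :: "nat \<Rightarrow> complex mat monoid" where
  "GL d = units_of (ring_mat TYPE(complex) d ())"

definition unitary :: "nat \<Rightarrow> complex mat \<Rightarrow> bool" where
  "unitary d g \<longleftrightarrow> g \<in> carrier_mat d d \<and> mat_adjoint g * g = 1\<^sub>m d"

definition reflection :: "nat \<Rightarrow> complex mat \<Rightarrow> bool" where
  "reflection d g \<longleftrightarrow> g \<in> carrier (GL d) \<and> vec_space.rank d (1\<^sub>m d - g) = 1"

text \<open>The generating set may be empty, so the trivial group counts as a reflection group
  (with no reflection orbits).\<close>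

definition complex_reflection_group :: "nat \<Rightarrow> complex mat set \<Rightarrow> bool" where
  "complex_reflection_group d G \<longleftrightarrow>
     finite G \<and> (\<forall>g\<in>G. unitary d g) \<and>
     (\<exists>S \<subseteq> Collect (reflection d). G = generate (GL d) S)"

abbreviation as_group :: "nat \<Rightarrow> complex mat set \<Rightarrow> complex mat monoid" where
  "as_group d G \<equiv> (GL d)\<lparr>carrier := G\<rparr>"

text \<open>For a reflection \<open>g\<close>, the vectors \<open>a\<close> with \<open>is_root d g a\<close> are exactly those that span the
  root line of \<open>g\<close>; here \<open>\<bullet>c\<close> is the Hermitian inner product.\<close>

definition is_root :: "nat \<Rightarrow> complex mat \<Rightarrow> complex vec \<Rightarrow> bool" where
  "is_root d g a \<longleftrightarrow> a \<in> carrier_vec d \<and> a \<noteq> 0\<^sub>v d \<and>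
     (\<forall>v\<in>carrier_vec d. g *\<^sub>v v = v \<longrightarrow> v \<bullet>c a = 0)"

definition roots :: "nat \<Rightarrow> complex mat set \<Rightarrow> complex vec set" where
  "roots d G = {a. \<exists>g\<in>G. reflection d g \<and> is_root d g a}"

definition root_subgroup :: "nat \<Rightarrow> complex mat set \<Rightarrow> complex vec \<Rightarrow> complex mat set" where
  "root_subgroup d G a = insert (1\<^sub>m d) {g \<in> G. reflection d g \<and> is_root d g a}"

definition reflection_orbit ::
    "nat \<Rightarrow> complex mat set \<Rightarrow> complex vec \<Rightarrow> complex mat set set" where
  "reflection_orbit d G a =
     (\<lambda>h. (h <#\<^bsub>GL d\<^esub> root_subgroup d G a) #>\<^bsub>GL d\<^esub> (inv\<^bsub>GL d\<^esub> h)) ` G"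

text \<open>The vectors \<open>a 0, \<dots>, a (m - 1)\<close> represent the reflection orbits of \<open>G\<close>, each exactly once, and
  the reflection type of \<open>G\<close> consists of \<open>n j\<close> copies of the cyclic group of order \<open>k j\<close>
  for \<open>j < m\<close>.\<close>

definition has_reflection_type ::
    "nat \<Rightarrow> complex mat set \<Rightarrow> nat \<Rightarrow> (nat \<Rightarrow> complex vec) \<Rightarrow> (nat \<Rightarrow> nat) \<Rightarrow> (nat \<Rightarrow> nat) \<Rightarrow> bool" where
  "has_reflection_type d G m a n k \<longleftrightarrow>
     a ` {..<m} \<subseteq> roots d G \<and>
     bij_betw (\<lambda>j. reflection_orbit d G (a j)) {..<m} (reflection_orbit d G ` roots d G) \<and>
     (\<forall>j<m. k j = card (root_subgroup d G (a j)) \<and> n j = card (reflection_orbit d G (a j)))"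

definition abelianisation :: "('a, 'b) monoid_scheme \<Rightarrow> 'a set monoid" where
  "abelianisation K = K Mod derived K (carrier K)"

definition abelianisation_map :: "('a, 'b) monoid_scheme \<Rightarrow> 'a \<Rightarrow> 'a set" where
  "abelianisation_map K g = derived K (carrier K) #>\<^bsub>K\<^esub> g"

text \<open>The product of the cyclic groups of orders \<open>k 0, \<dots>, k (m - 1)\<close>, written additively
  in each factor, its internal direct summands, and its diagonal action on \<open>m\<close>-dimensional complex
  space, in which the generator \<open>1\<close> of the \<open>j\<close>-th factor multiplies the \<open>j\<close>-th coordinate by
  a primitive root of unity of order \<open>k j\<close>.\<close>

definition cyclic_product :: "nat \<Rightarrow> (nat \<Rightarrow> nat) \<Rightarrow> (nat \<Rightarrow> int) monoid" where
  "cyclic_product m k = product_group {..<m} (\<lambda>j. integer_mod_group (k j))"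

definition cyclic_summand :: "nat \<Rightarrow> (nat \<Rightarrow> nat) \<Rightarrow> nat \<Rightarrow> (nat \<Rightarrow> int) set" where
  "cyclic_summand m k j =
     {x \<in> carrier (cyclic_product m k). \<forall>i<m. i \<noteq> j \<longrightarrow> x i = \<one>\<^bsub>integer_mod_group (k i)\<^esub>}"

definition diagonal_action :: "nat \<Rightarrow> (nat \<Rightarrow> nat) \<Rightarrow> (nat \<Rightarrow> int) \<Rightarrow> complex mat" where
  "diagonal_action m k x =
     mat m m (\<lambda>(i, j). if i = j then cis (2 * pi * of_int (x j) / of_nat (k j)) else 0)"

end

theory Submission
  imports Defs
begin

text \<open>A unitary reflection with root \<open>a\<close> has the form \<open>1 - (1 - z) a a\<^sup>* / \<langle>a, a\<rangle>\<close> with \<open>z \<noteq> 1\<close>, so the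
  root subgroup of \<open>a\<^sub>j\<close> is a copy of the group of all \<open>k\<^sub>j\<close>-th roots of unity. For each orbit \<open>j\<close>,
  the product \<open>f\<^sub>j\<close> of the linear forms that define the mirrors in the orbit is a semi-invariant: \<open>G\<close> acts
  on it by a linear character \<open>\<chi>\<^sub>j\<close>, which takes the value \<open>z\<close> on the reflections in orbit \<open>j\<close> and the
  value \<open>1\<close> on all others. Together the characters give a homomorphism from \<open>G\<close> onto the product of
  the cyclic groups. An element is determined modulo \<open>[G, G]\<close> by its character values, because \<open>G\<close> is
  generated by reflections and each reflection is conjugate to one with root some \<open>a\<^sub>i\<close>; hence the
  kernel is exactly \<open>[G, G]\<close>.\<close>

section \<open>Unitary reflections\<close>

text \<open>Unitarity lets one vector carry all the geometry of a reflection: the root spans the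
  image of \<open>1 - g\<close>, and its orthogonal complement is the mirror. The defining forms of
  the mirrors can thus be taken as v -> \<open>v \<bullet>c b\<close>, and G moves a form by moving
  b. Since a root is determined only up to a scalar, G permutes the chosen forms up to unknown
  scalars, and the character collects their product. The difficulty is that a reflection may permute
  the mirrors other than its own, yet must contribute nothing through them. The products of forms
  are treated as functions on the space, not as polynomials, and scalars are compared at points
  where these functions do not vanish; such points exist because finitely many hyperplanes cannot
  cover a subspace that lies in none of them. For the kernel, g is compared modulo [G, G] with an
  explicit product of reflections whose roots are the \<open>a j\<close> and whose parameters are
  the character values of g.\<close>

definition hrefl :: "nat \<Rightarrow> complex vec \<Rightarrow> complex \<Rightarrow> complex mat" where
  "hrefl d a z = mat d d (\<lambda>(i, j). (if i = j then 1 else 0) - (1 - z) / (a \<bullet>c a) * a $ i * cnj (a $ j))"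

lemma hrefl_carrier [simp]: "hrefl d a z \<in> carrier_mat d d"
  by (simp add: hrefl_def)

section \<open>Matrices acting on vectors, and unitary matrices\<close>

lemma mat_eqI_mult_vec:
  fixes A B :: "'a::comm_ring_1 mat"
  assumes A: "A \<in> carrier_mat r c" and B: "B \<in> carrier_mat r c"
    and eq: "\<And>v. v \<in> carrier_vec c \<Longrightarrow> A *\<^sub>v v = B *\<^sub>v v"
  shows "A = B"
proof (rule eq_matI)
  fix i j assume "i < dim_row B" "j < dim_col B"
  with A B have ij: "i < r" "j < c" by auto
  have "row A i \<bullet> unit_vec c j = row B i \<bullet> unit_vec c j"
    using arg_cong[OF eq[of "unit_vec c j"], of "\<lambda>v. v $ i"] ij A B by simp
  then show "A $$ (i, j) = B $$ (i, j)"
    using ij A B by simp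
qed (use A B in auto)

lemma cscalar_eq_sum:
  fixes v w :: "complex vec"
  shows "v \<in> carrier_vec d \<Longrightarrow> w \<in> carrier_vec d \<Longrightarrow> v \<bullet>c w = (\<Sum>i<d. v $ i * cnj (w $ i))"
  by (simp add: scalar_prod_def atLeast0LessThan)

lemma hrefl_mult_vec:
  assumes a: "a \<in> carrier_vec d" and v: "v \<in> carrier_vec d"
  shows "hrefl d a z *\<^sub>v v = v - ((1 - z) * (v \<bullet>c a) / (a \<bullet>c a)) \<cdot>\<^sub>v a"
proof (rule eq_vecI)
  fix i assume "i < dim_vec (v - ((1 - z) * (v \<bullet>c a) / (a \<bullet>c a)) \<cdot>\<^sub>v a)"
  with a have i: "i < d" by simp
  have "(hrefl d a z *\<^sub>v v) $ i =
      (\<Sum>j<d. ((if i = j then 1 else 0) - (1 - z) / (a \<bullet>c a) * a $ i * cnj (a $ j)) * v $ j)"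
    using i v by (simp add: hrefl_def scalar_prod_def atLeast0LessThan)
  also have "\<dots> = (\<Sum>j<d. (if i = j then v $ j else 0) - ((1 - z) / (a \<bullet>c a) * a $ i) * (v $ j * cnj (a $ j)))"
    by (rule sum.cong) (auto simp: algebra_simps)
  also have "\<dots> = v $ i - ((1 - z) / (a \<bullet>c a) * a $ i) * (v \<bullet>c a)"
    using i by (simp only: sum_subtractf cscalar_eq_sum[OF v a] sum_distrib_left) simp
  finally show "(hrefl d a z *\<^sub>v v) $ i = (v - ((1 - z) * (v \<bullet>c a) / (a \<bullet>c a)) \<cdot>\<^sub>v a) $ i"
    using i a by simp
qed (use a v in \<open>simp add: hrefl_def\<close>)

lemma cscalar_mult_mat_vec:
  fixes A :: "complex mat"
  assumes A: "A \<in> carrier_mat d d" and v: "v \<in> carrier_vec d" and w: "w \<in> carrier_vec d"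
  shows "(A *\<^sub>v v) \<bullet>c w = v \<bullet>c (mat_adjoint A *\<^sub>v w)"
proof -
  have adj: "mat_adjoint A \<in> carrier_mat d d"
    using A by (auto simp: mat_adjoint_def)
  have entry: "mat_adjoint A $$ (i, j) = cnj (A $$ (j, i))" if "i < d" "j < d" for i j
    using that A by (simp add: mat_adjoint_def mat_of_rows_def)
  have "(A *\<^sub>v v) \<bullet>c w = (\<Sum>i<d. \<Sum>j<d. A $$ (i, j) * v $ j * cnj (w $ i))"
    using A v w by (simp add: scalar_prod_def atLeast0LessThan sum_distrib_right)
  also have "\<dots> = (\<Sum>j<d. \<Sum>i<d. A $$ (i, j) * v $ j * cnj (w $ i))"
    by (rule sum.swap)
  also have "\<dots> = (\<Sum>j<d. v $ j * cnj (\<Sum>i<d. mat_adjoint A $$ (j, i) * w $ i))"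
    by (intro sum.cong) (auto simp: sum_distrib_left entry mult_ac)
  also have "\<dots> = v \<bullet>c (mat_adjoint A *\<^sub>v w)"
    using adj v w by (simp add: scalar_prod_def atLeast0LessThan)
  finally show ?thesis .
qed

lemma unitary_carrier: "unitary d g \<Longrightarrow> g \<in> carrier_mat d d"
  by (simp add: unitary_def)

lemma unitary_cscalar:
  assumes g: "unitary d g" and v: "v \<in> carrier_vec d" and w: "w \<in> carrier_vec d"
  shows "(g *\<^sub>v v) \<bullet>c (g *\<^sub>v w) = v \<bullet>c w"
proof -
  have c: "g \<in> carrier_mat d d" "mat_adjoint g \<in> carrier_mat d d"
    using g by (auto simp: unitary_def mat_adjoint_def)
  have "mat_adjoint g *\<^sub>v (g *\<^sub>v w) = (mat_adjoint g * g) *\<^sub>v w"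
    using c w by simp
  also have "\<dots> = w" using g w by (simp add: unitary_def)
  finally show ?thesis
    using cscalar_mult_mat_vec[OF c(1) v, of "g *\<^sub>v w"] c w by simp
qed

lemma carrier_GL: "carrier (GL d) = {g \<in> carrier_mat d d. \<exists>h\<in>carrier_mat d d. h * g = 1\<^sub>m d \<and> g * h = 1\<^sub>m d}"
  by (auto simp: GL_def units_of_def Units_def ring_mat_def)

lemma GL_simps [simp]: "monoid.mult (GL d) = (*)" "one (GL d) = 1\<^sub>m d"
  by (auto simp: GL_def units_of_def ring_mat_def)

lemma group_GL [simp]: "group (GL d)"
  unfolding GL_def by (intro monoid.units_group ring.is_monoid ring_mat)

lemma unitary_in_GL: "unitary d g \<Longrightarrow> g \<in> carrier (GL d)"
proof -
  assume "unitary d g"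
  then have "g \<in> carrier_mat d d" "mat_adjoint g \<in> carrier_mat d d" "mat_adjoint g * g = 1\<^sub>m d"
    by (auto simp: unitary_def mat_adjoint_def)
  then show ?thesis
    unfolding carrier_GL using mat_mult_left_right_inverse by blast
qed

text \<open>A maximal independent set of columns has as many members as the rank, so it is a single
  column u. Any other column w depends on u, since {u, w} would otherwise be a larger independent
  set. As u is itself a column, some coefficient is nonzero.\<close>

lemma rank_1_imp_product:
  fixes A :: "'a::field mat"
  assumes A: "A \<in> carrier_mat r c" and rk: "vec_space.rank r A = 1"
  shows "\<exists>u f. u \<in> carrier_vec r \<and> u \<noteq> 0\<^sub>v r \<and> (\<forall>j<c. col A j = f j \<cdot>\<^sub>v u) \<and> (\<exists>j<c. f j \<noteq> 0)"
proof -
  interpret vec_space "TYPE('a)" r .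
  obtain S where S: "maximal S (\<lambda>T. T \<subseteq> set (cols A) \<and> lin_indpt T)"
    using maximal_exists_superset[of "set (cols A)" "\<lambda>T. T \<subseteq> set (cols A) \<and> lin_indpt T" "{}"]
    by (auto simp: maximal_def lin_dep_def)
  then have "card S = 1"
    using rank_card_indpt[OF A S] rk by simp
  then obtain u where Su: "S = {u}"
    using card_1_singletonE by blast
  have uc: "u \<in> set (cols A)" and li: "lin_indpt {u}"
    using S Su by (auto simp: maximal_def)
  have u: "u \<in> carrier_vec r"
    using uc cols_dim A by blast
  have u0: "u \<noteq> 0\<^sub>v r"
    proof -
    have "UNIV \<noteq> {0 :: 'a}" by (metis UNIV_I singletonD zero_neq_one)
    then show ?thesis using li zero_nin_lin_indpt[of "{u}"] u by auto
  qed
  have mult: "\<exists>t. w = t \<cdot>\<^sub>v u" if w: "w \<in> set (cols A)" for w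
  proof (cases "w = u")
    case True
    then show ?thesis by (intro exI[of _ 1]) simp
  next
    case False
    have wc: "w \<in> carrier_vec r" using w cols_dim A by blast
    let ?M = "mat_of_cols r [u, w]"
    have M: "?M \<in> carrier_mat r 2" by (auto simp: mat_of_cols_def)
    have cM: "cols ?M = [u, w]" using u wc by (simp add: cols_mat_of_cols)
    have "lin_dep {u, w}"
    proof (rule ccontr)
      assume "\<not> lin_dep {u, w}"
      moreover have "\<And>B. S \<subseteq> B \<Longrightarrow> B \<subseteq> set (cols A) \<Longrightarrow> lin_indpt B \<Longrightarrow> B = S"
        using S unfolding maximal_def by blast
      ultimately have "{u, w} = S" using w uc Su by auto
      with Su False show False by auto
    qed
    then have ld: "lin_dep (set (cols ?M))"
      by (simp add: cM)
    obtain x where x: "x \<in> carrier_vec 2" "x \<noteq> 0\<^sub>v 2" "?M *\<^sub>v x = 0\<^sub>v r"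
      using lin_depE[OF M ld] False cM by auto
    have eq: "u $ i * x $ 0 + w $ i * x $ 1 = 0" if "i < r" for i
      using arg_cong[OF x(3), of "\<lambda>v. v $ i"] that x(1) M
      by (auto simp: scalar_prod_def numeral_2_eq_2 mat_of_cols_def)
    have "x $ 1 \<noteq> 0"
    proof
      assume 1: "x $ 1 = 0"
      then have "x $ 0 \<noteq> 0" using x(1,2)
        by (auto simp: vec_eq_iff less_2_cases_iff)
      then have "u = 0\<^sub>v r" using eq 1 u by (intro eq_vecI) auto
      with u0 show False ..
    qed
    then have "w = (- x $ 0 / x $ 1) \<cdot>\<^sub>v u"
      using eq u wc by (intro eq_vecI) (auto simp: field_simps add_eq_0_iff)
    then show ?thesis ..
  qed
  have cj: "col A j \<in> set (cols A)" if "j < c" for j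
    using that A by (metis carrier_matD(2) cols_length cols_nth nth_mem)
  define f where "f j = (SOME t. col A j = t \<cdot>\<^sub>v u)" for j
  have f: "col A j = f j \<cdot>\<^sub>v u" if "j < c" for j
    unfolding f_def by (rule someI_ex) (rule mult[OF cj[OF that]])
  obtain j where "j < c" "u = col A j"
    using uc A by (metis carrier_matD(2) cols_length cols_nth in_set_conv_nth)
  then have "f j \<noteq> 0" using f[of j] u0 u by auto
  with f u u0 \<open>j < c\<close> show ?thesis by blast
qed

text \<open>The product form bounds the rank by 1 from above; a column with a nonzero entry is an
  independent set by itself and bounds it from below.\<close>

lemma rank_1_I:
  fixes A :: "'a::field mat"
  assumes A: "A \<in> carrier_mat r c"
    and fg: "\<And>i j. i < r \<Longrightarrow> j < c \<Longrightarrow> A $$ (i, j) = f i * g j"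
    and nz: "A \<noteq> 0\<^sub>m r c"
  shows "vec_space.rank r A = 1"
proof -
  interpret vec_space "TYPE('a)" r .
  have le: "rank A \<le> 1"
    using rank_le_1_product_entries[OF A, of f g] fg A by simp
  obtain i j where ij: "i < r" "j < c" "A $$ (i, j) \<noteq> 0"
    using nz A by (metis carrier_matD eq_matI index_zero_mat)
  let ?w = "col A j"
  have w: "?w \<in> carrier_vec r" "?w \<in> set (cols A)" "?w \<noteq> 0\<^sub>v r"
  proof -
    show "?w \<in> carrier_vec r" using A by auto
    show "?w \<in> set (cols A)" using ij A by (metis carrier_matD(2) cols_length cols_nth nth_mem)
    show "?w \<noteq> 0\<^sub>v r" using ij A by (metis carrier_matD(1,2) index_col index_zero_vec(1))
  qed
  let ?M = "mat_of_cols r [?w]"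
  have cM: "cols ?M = [?w]" using w by (simp add: cols_mat_of_cols)
  have M: "?M \<in> carrier_mat r 1" by (auto simp: mat_of_cols_def)
  have "lin_indpt {?w}"
  proof
    assume "lin_dep {?w}"
    then have ld: "lin_dep (set (cols ?M))" by (simp add: cM)
    obtain x where x: "x \<in> carrier_vec 1" "x \<noteq> 0\<^sub>v 1" "?M *\<^sub>v x = 0\<^sub>v r"
      using lin_depE[OF M ld] cM by auto
    have "A $$ (i, j) * x $ 0 = 0"
      using arg_cong[OF x(3), of "\<lambda>v. v $ i"] ij x(1) A
      by (auto simp: scalar_prod_def mat_of_cols_def)
    with ij have "x $ 0 = 0" by simp
    then have "x = 0\<^sub>v 1" using x(1) by (intro eq_vecI) auto
    with x show False by simp
  qed
  then have "card {?w} \<le> rank A"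
    using rank_ge_card_indpt[OF A, of "{?w}"] w by simp
  with le show ?thesis by simp
qed

section \<open>The algebra of the matrices \<open>hrefl d a z\<close>\<close>

lemma hrefl_self:
  assumes a: "a \<in> carrier_vec d" "a \<noteq> 0\<^sub>v d"
  shows "hrefl d a z *\<^sub>v a = z \<cdot>\<^sub>v a"
proof -
  have "(1 - z) * (a \<bullet>c a) / (a \<bullet>c a) = 1 - z" using a by simp
  then have "hrefl d a z *\<^sub>v a = a - (1 - z) \<cdot>\<^sub>v a"
    by (simp only: hrefl_mult_vec[OF a(1) a(1)])
  then show ?thesis
    using a(1) by (auto simp: algebra_simps intro!: eq_vecI)
qed

text \<open>Numerator and denominator of the projection onto the line of a both pick up the factor
  \<open>s * cnj s\<close>. So \<open>hrefl\<close> depends on the root line only, and any root may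
  be exchanged for a multiple.\<close>

lemma hrefl_smult:
  assumes a: "a \<in> carrier_vec d" and s: "s \<noteq> 0"
  shows "hrefl d (s \<cdot>\<^sub>v a) z = hrefl d a z"
proof -
  have N: "(s \<cdot>\<^sub>v a) \<bullet>c (s \<cdot>\<^sub>v a) = s * (cnj s * (a \<bullet>c a))"
    using a by (simp add: conjugate_smult_vec)
  have scale: "(1 - z) / (s * (cnj s * N)) * (s * x) * (cnj s * y) = (1 - z) / N * x * y" for N x y
    using s by (simp add: divide_simps)
  have ent: "(s \<cdot>\<^sub>v a) $ i = s * a $ i" if "i < d" for i using that a by simp
  show ?thesis
    unfolding hrefl_def N
    by (rule cong_mat) (simp_all only: ent scale complex_cnj_mult case_prod_conv)
qed

lemma hrefl_1 [simp]: "hrefl d a 1 = 1\<^sub>m d"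
  by (auto simp: hrefl_def one_mat_def)

lemma hrefl_mult:
  assumes a: "a \<in> carrier_vec d" "a \<noteq> 0\<^sub>v d"
  shows "hrefl d a z * hrefl d a y = hrefl d a (z * y)"
proof (rule mat_eqI_mult_vec)
  fix v :: "complex vec" assume v: "v \<in> carrier_vec d"
  define N where "N = a \<bullet>c a"
  define c where "c = (1 - y) * (v \<bullet>c a) / N"
  have N: "N \<noteq> 0" using a by (simp add: N_def)
  have "(v - c \<cdot>\<^sub>v a) \<bullet>c a = v \<bullet>c a - c * N"
    using a v by (simp add: minus_scalar_prod_distrib[of _ d] N_def)
  moreover have "c * N = (1 - y) * (v \<bullet>c a)" using N by (simp add: c_def)
  ultimately have *: "(v - c \<cdot>\<^sub>v a) \<bullet>c a = y * (v \<bullet>c a)"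
    by (simp add: left_diff_distrib)
  have "(hrefl d a z * hrefl d a y) *\<^sub>v v = hrefl d a z *\<^sub>v (v - c \<cdot>\<^sub>v a)"
    using a v by (simp add: assoc_mult_mat_vec[of _ d d _ d] hrefl_mult_vec c_def N_def)
  also have "\<dots> = (v - c \<cdot>\<^sub>v a) - ((1 - z) * (y * (v \<bullet>c a)) / N) \<cdot>\<^sub>v a"
    using a v by (simp add: hrefl_mult_vec * flip: N_def)
  also have "\<dots> = v - ((1 - z * y) * (v \<bullet>c a) / N) \<cdot>\<^sub>v a"
    using a v N by (intro eq_vecI) (auto simp: c_def field_simps)
  also have "\<dots> = hrefl d a (z * y) *\<^sub>v v"
    using a v by (simp add: hrefl_mult_vec N_def)
  finally show "(hrefl d a z * hrefl d a y) *\<^sub>v v = hrefl d a (z * y) *\<^sub>v v" .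
qed (auto intro: mult_carrier_mat[of _ d d _ d])

lemma hrefl_eq_iff:
  assumes "a \<in> carrier_vec d" "a \<noteq> 0\<^sub>v d"
  shows "hrefl d a z = hrefl d a y \<longleftrightarrow> z = y"
proof
  assume "hrefl d a z = hrefl d a y"
  then have eq: "z \<cdot>\<^sub>v a = y \<cdot>\<^sub>v a" using hrefl_self[OF assms] by metis
  obtain i where "i < d" "a $ i \<noteq> 0" using assms by (auto simp: vec_eq_iff)
  then show "z = y" using arg_cong[OF eq, of "\<lambda>v. v $ i"] assms by simp
qed simp

text \<open>A unitary g preserves both inner products in the formula for \<open>hrefl\<close>, so it
  carries a to \<open>g *\<^sub>v a\<close> and keeps z. The inverse of g is avoided, so no ambient
  group is involved.\<close>

lemma hrefl_conj:
  assumes g: "unitary d g" and a: "a \<in> carrier_vec d"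
  shows "g * hrefl d a z = hrefl d (g *\<^sub>v a) z * g"
proof (rule mat_eqI_mult_vec)
  have gc: "g \<in> carrier_mat d d" using g by (rule unitary_carrier)
  show "g * hrefl d a z \<in> carrier_mat d d" "hrefl d (g *\<^sub>v a) z * g \<in> carrier_mat d d"
    using gc by (auto intro: mult_carrier_mat[of _ d d _ d])
  fix v :: "complex vec" assume v: "v \<in> carrier_vec d"
  have "(g * hrefl d a z) *\<^sub>v v = g *\<^sub>v v - ((1 - z) * (v \<bullet>c a) / (a \<bullet>c a)) \<cdot>\<^sub>v (g *\<^sub>v a)"
    using gc v a by (simp add: assoc_mult_mat_vec[of _ d d _ d] hrefl_mult_vec mult_minus_distrib_mat_vec[of _ d d] mult_mat_vec[of _ d d])
  also have "\<dots> = hrefl d (g *\<^sub>v a) z *\<^sub>v (g *\<^sub>v v)"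
    using gc v a by (simp add: hrefl_mult_vec unitary_cscalar[OF g])
  also have "\<dots> = (hrefl d (g *\<^sub>v a) z * g) *\<^sub>v v"
    using gc v a by (simp add: assoc_mult_mat_vec[of _ d d _ d])
  finally show "(g * hrefl d a z) *\<^sub>v v = (hrefl d (g *\<^sub>v a) z * g) *\<^sub>v v" .
qed

lemma hrefl_cscalar:
  assumes a: "a \<in> carrier_vec d" "a \<noteq> 0\<^sub>v d" and v: "v \<in> carrier_vec d"
  shows "(hrefl d a z *\<^sub>v v) \<bullet>c a = z * (v \<bullet>c a)"
proof -
  have "(1 - z) * (v \<bullet>c a) / (a \<bullet>c a) * (a \<bullet>c a) = (1 - z) * (v \<bullet>c a)" using a by simp
  then show ?thesis
    using a(1) v by (simp add: hrefl_mult_vec minus_scalar_prod_distrib[of _ d]) (simp add: algebra_simps)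
qed

lemma hrefl_fixes_iff:
  assumes a: "a \<in> carrier_vec d" "a \<noteq> 0\<^sub>v d" and v: "v \<in> carrier_vec d" and z: "z \<noteq> 1"
  shows "hrefl d a z *\<^sub>v v = v \<longleftrightarrow> v \<bullet>c a = 0"
proof
  assume "hrefl d a z *\<^sub>v v = v"
  then have "z * (v \<bullet>c a) = v \<bullet>c a" using hrefl_cscalar[OF a v, of z] by simp
  then show "v \<bullet>c a = 0" using z by simp
next
  assume "v \<bullet>c a = 0"
  then show "hrefl d a z *\<^sub>v v = v" using a v by (auto simp: hrefl_mult_vec)
qed

text \<open>Subtract from b its projection onto a. The remainder is orthogonal to a, hence by
  \<open>orth\<close> to b, hence to itself, and so vanishes.\<close>

lemma orthogonal_complement_subset_imp_multiple:
  fixes a b :: "complex vec"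
  assumes a: "a \<in> carrier_vec d" "a \<noteq> 0\<^sub>v d" and b: "b \<in> carrier_vec d"
    and orth: "\<And>v. v \<in> carrier_vec d \<Longrightarrow> v \<bullet>c a = 0 \<Longrightarrow> v \<bullet>c b = 0"
  shows "\<exists>s. b = s \<cdot>\<^sub>v a"
proof -
  define s where "s = (b \<bullet>c a) / (a \<bullet>c a)"
  define v where "v = b - s \<cdot>\<^sub>v a"
  have N: "a \<bullet>c a \<noteq> 0" using a by simp
  have v: "v \<in> carrier_vec d" using a b by (simp add: v_def)
  have va: "v \<bullet>c a = 0"
    using a b N by (simp add: v_def s_def minus_scalar_prod_distrib[of _ d])
  then have vb: "v \<bullet>c b = 0" using v by (rule orth[rotated])
  have "v \<bullet>c v = v \<bullet>c b - cnj s * (v \<bullet>c a)"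
    using a b v by (simp add: cscalar_eq_sum[of _ d] v_def sum_distrib_left sum_subtractf[symmetric] algebra_simps)
  with va vb have "v = 0\<^sub>v d" using v by simp
  then have "b $ i = (s \<cdot>\<^sub>v a) $ i" if "i < d" for i
    using that a b by (metis (no_types, lifting) carrier_vecD diff_eq_diff_eq diff_self index_minus_vec(1) index_smult_vec(2) index_zero_vec(1) v_def)
  then have "b = s \<cdot>\<^sub>v a" using a b by (intro eq_vecI) auto
  then show ?thesis ..
qed

text \<open>The fixed space is the orthogonal complement of a, and the vectors orthogonal to all of
  it are the multiples of a. This recovers the root line from the matrix.\<close>

lemma is_root_hrefl:
  assumes a: "a \<in> carrier_vec d" "a \<noteq> 0\<^sub>v d" and z: "z \<noteq> 1"
  shows "is_root d (hrefl d a z) b \<longleftrightarrow> (\<exists>s. s \<noteq> 0 \<and> b = s \<cdot>\<^sub>v a)"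
proof
  assume r: "is_root d (hrefl d a z) b"
  then obtain s where "b = s \<cdot>\<^sub>v a"
    using orthogonal_complement_subset_imp_multiple[OF a, of b] hrefl_fixes_iff[OF a _ z]
    by (auto simp: is_root_def)
  moreover from this have "s \<noteq> 0" using r a by (auto simp: is_root_def)
  ultimately show "\<exists>s. s \<noteq> 0 \<and> b = s \<cdot>\<^sub>v a" by blast
next
  assume "\<exists>s. s \<noteq> 0 \<and> b = s \<cdot>\<^sub>v a"
  then obtain s where s: "s \<noteq> 0" "b = s \<cdot>\<^sub>v a" by blast
  moreover have "s \<cdot>\<^sub>v a \<noteq> 0\<^sub>v d"
    using a s(1) by (auto simp: vec_eq_iff)
  ultimately show "is_root d (hrefl d a z) b"
    using a hrefl_fixes_iff[OF a _ z] by (auto simp: is_root_def conjugate_smult_vec)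
qed

lemma hrefl_in_GL_iff:
  assumes a: "a \<in> carrier_vec d" "a \<noteq> 0\<^sub>v d"
  shows "hrefl d a z \<in> carrier (GL d) \<longleftrightarrow> z \<noteq> 0"
proof
  assume "hrefl d a z \<in> carrier (GL d)"
  then obtain h where h: "h \<in> carrier_mat d d" "h * hrefl d a z = 1\<^sub>m d" by (auto simp: carrier_GL)
  show "z \<noteq> 0"
  proof
    assume "z = 0"
    then have "hrefl d a z *\<^sub>v a = 0\<^sub>v d" using hrefl_self[OF a, of z] a by auto
    then have "(h * hrefl d a z) *\<^sub>v a = 0\<^sub>v d"
      using h(1) a by (auto simp: assoc_mult_mat_vec[of _ d d _ d])
    moreover have "(h * hrefl d a z) *\<^sub>v a = a" using h(2) a by simp
    ultimately show False using a by simp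
  qed
next
  assume "z \<noteq> 0"
  then show "hrefl d a z \<in> carrier (GL d)"
    by (auto simp: carrier_GL hrefl_mult[OF a] intro!: bexI[of _ "hrefl d a (inverse z)"])
qed

lemma reflection_hrefl:
  assumes a: "a \<in> carrier_vec d" "a \<noteq> 0\<^sub>v d" and z: "z \<noteq> 0" "z \<noteq> 1"
  shows "reflection d (hrefl d a z)"
proof -
  have "1\<^sub>m d - hrefl d a z \<noteq> 0\<^sub>m d d"
  proof
    assume eq: "1\<^sub>m d - hrefl d a z = 0\<^sub>m d d"
    have "hrefl d a z $$ (i, j) = 1\<^sub>m d $$ (i, j)" if "i < d" "j < d" for i j
      using arg_cong[OF eq, of "\<lambda>A. A $$ (i, j)"] that by (simp add: carrier_matD[OF hrefl_carrier])
    then have "hrefl d a z = 1\<^sub>m d"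
      by (intro eq_matI) (auto simp: carrier_matD[OF hrefl_carrier])
    then show False using hrefl_eq_iff[OF a, of z 1] z by simp
  qed
  then have "vec_space.rank d (1\<^sub>m d - hrefl d a z) = 1"
    by (intro rank_1_I[of _ _ _ "\<lambda>i. (1 - z) / (a \<bullet>c a) * a $ i" "\<lambda>j. cnj (a $ j)"])
      (auto simp: hrefl_def intro!: minus_carrier_mat)
  then show ?thesis using hrefl_in_GL_iff[OF a] z by (simp add: reflection_def)
qed

text \<open>Rank one gives \<open>g *\<^sub>v v = v - (v \<bullet>c w) \<cdot>\<^sub>v u\<close>, so
  g fixes the complement of w pointwise. Since g preserves inner products, it maps w to a vector
  orthogonal to that complement, that is, to a multiple z w. Comparing this with the formula at v =
  w makes u parallel to w with exactly the coefficient that occurs in \<open>hrefl\<close>.\<close>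

lemma unitary_reflection_eq_hrefl:
  assumes g: "unitary d g" and r: "reflection d g"
  shows "\<exists>a z. a \<in> carrier_vec d \<and> a \<noteq> 0\<^sub>v d \<and> z \<noteq> 0 \<and> z \<noteq> 1 \<and> g = hrefl d a z"
proof -
  have gc: "g \<in> carrier_mat d d" using g by (rule unitary_carrier)
  obtain u f where u: "u \<in> carrier_vec d" "u \<noteq> 0\<^sub>v d"
    and col: "\<And>j. j < d \<Longrightarrow> col (1\<^sub>m d - g) j = f j \<cdot>\<^sub>v u" and f: "\<exists>j<d. f j \<noteq> 0"
    using rank_1_imp_product[of "1\<^sub>m d - g" d d] r gc
    unfolding reflection_def by (metis minus_carrier_mat)
  \<comment> \<open>The conjugates turn the linear form with coefficients \<open>f j\<close> into
    the inner product with w.\<close>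
  define w where "w = vec d (\<lambda>j. cnj (f j))"
  have w: "w \<in> carrier_vec d" "w \<noteq> 0\<^sub>v d" using f by (auto simp: w_def vec_eq_iff)
  have act: "g *\<^sub>v v = v - (v \<bullet>c w) \<cdot>\<^sub>v u" if v: "v \<in> carrier_vec d" for v
  proof (rule eq_vecI)
    fix i assume "i < dim_vec (v - (v \<bullet>c w) \<cdot>\<^sub>v u)"
    then have i: "i < d" using u by simp
    have ent: "g $$ (i, j) = (if i = j then 1 else 0) - f j * u $ i" if "j < d" for j
      using arg_cong[OF col[OF that], of "\<lambda>x. x $ i"] that i gc u
      by (auto simp: algebra_simps)
    have "(g *\<^sub>v v) $ i = (\<Sum>j<d. ((if i = j then 1 else 0) - f j * u $ i) * v $ j)"
      using i gc v by (simp add: scalar_prod_def atLeast0LessThan ent)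
    also have "\<dots> = (\<Sum>j<d. (if i = j then v $ j else 0) - (v $ j * cnj (w $ j)) * u $ i)"
      by (rule sum.cong) (auto simp: w_def algebra_simps)
    also have "\<dots> = v $ i - (v \<bullet>c w) * u $ i"
      using i by (simp add: sum_subtractf cscalar_eq_sum[OF v w(1)] flip: sum_distrib_right)
    finally show "(g *\<^sub>v v) $ i = (v - (v \<bullet>c w) \<cdot>\<^sub>v u) $ i"
      using i u v by simp
  qed (use u gc in auto)
  have "v \<bullet>c (g *\<^sub>v w) = 0" if v: "v \<in> carrier_vec d" and o: "v \<bullet>c w = 0" for v
  proof -
    have "g *\<^sub>v v = v" using act[OF v] o u v by auto
    then show ?thesis using unitary_cscalar[OF g v w(1)] o by simp
  qed
  then obtain z where z: "g *\<^sub>v w = z \<cdot>\<^sub>v w"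
    using orthogonal_complement_subset_imp_multiple[OF w, of "g *\<^sub>v w"] gc w by auto
  have N: "w \<bullet>c w \<noteq> 0" using w by simp
  have ueq: "u = ((1 - z) / (w \<bullet>c w)) \<cdot>\<^sub>v w"
  proof (rule eq_vecI)
    fix i assume "i < dim_vec (((1 - z) / (w \<bullet>c w)) \<cdot>\<^sub>v w)"
    then have "i < d" using w by simp
    then have "w $ i - (w \<bullet>c w) * u $ i = z * w $ i"
      using arg_cong[OF trans[OF act[OF w(1), symmetric] z], of "\<lambda>x. x $ i"] w u by simp
    then show "u $ i = (((1 - z) / (w \<bullet>c w)) \<cdot>\<^sub>v w) $ i"
      using N \<open>i < d\<close> w by (simp add: field_simps)
  qed (use u w in auto)
  have gw: "g = hrefl d w z"
    using act w by (intro mat_eqI_mult_vec[OF gc hrefl_carrier])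
      (auto simp: hrefl_mult_vec ueq smult_smult_assoc mult_ac)
  have "z \<noteq> 1" using ueq u w by auto
  moreover have "z \<noteq> 0"
    using hrefl_in_GL_iff[OF w, of z] unitary_in_GL[OF g] gw by simp
  ultimately show ?thesis using gw w by blast
qed

section \<open>Root subgroups and reflection orbits\<close>

text \<open>If v works for I and w works for j, move along the line v + t w: each of the finitely
  many conditions excludes at most one t, and the field is infinite.\<close>

lemma generic_vector:
  fixes b :: "'i \<Rightarrow> complex vec"
  assumes "finite I" and W: "W \<subseteq> carrier_vec d" "0\<^sub>v d \<in> W"
    and closed: "\<And>v w t. v \<in> W \<Longrightarrow> w \<in> W \<Longrightarrow> v + t \<cdot>\<^sub>v w \<in> W"
    and b: "\<And>i. i \<in> I \<Longrightarrow> b i \<in> carrier_vec d"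
    and nz: "\<And>i. i \<in> I \<Longrightarrow> \<exists>w\<in>W. w \<bullet>c b i \<noteq> 0"
  shows "\<exists>v\<in>W. \<forall>i\<in>I. v \<bullet>c b i \<noteq> 0"
  using \<open>finite I\<close> b nz
proof (induction I)
  case empty
  then show ?case using W by auto
next
  case (insert j I)
  then obtain v w where v: "v \<in> W" "\<And>i. i \<in> I \<Longrightarrow> v \<bullet>c b i \<noteq> 0"
    and w: "w \<in> W" "w \<bullet>c b j \<noteq> 0"
    by (metis insertCI)
  \<comment> \<open>A denominator may be zero, in which case the division yields 0 and merely
    excludes t = 0 as well.\<close>
  have "finite ((\<lambda>i. - (v \<bullet>c b i) / (w \<bullet>c b i)) ` insert j I)" (is "finite ?B")
    using insert.hyps by simp
  then obtain t where t: "t \<notin> ?B"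
    using ex_new_if_finite infinite_UNIV_char_0 by blast
  have "(v + t \<cdot>\<^sub>v w) \<bullet>c b i \<noteq> 0" if i: "i \<in> insert j I" for i
  proof
    have car: "v \<in> carrier_vec d" "w \<in> carrier_vec d" "b i \<in> carrier_vec d"
      using v w W insert.prems i by auto
    assume "(v + t \<cdot>\<^sub>v w) \<bullet>c b i = 0"
    then have 0: "v \<bullet>c b i + t * (w \<bullet>c b i) = 0"
      using car by (simp add: add_scalar_prod_distrib[of _ d])
    have wi: "w \<bullet>c b i \<noteq> 0"
      using 0 v(2) w(2) i by auto
    from 0 have "t * (w \<bullet>c b i) = - (v \<bullet>c b i)" by (simp add: add_eq_0_iff)
    with wi have "t = - (v \<bullet>c b i) / (w \<bullet>c b i)" by (metis nonzero_eq_divide_eq)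
    with t i show False by blast
  qed
  then show ?case using closed[OF v(1) w(1)] by blast
qed

text \<open>Generation by reflections is left out on purpose: the characters of the orbits exist for
  every finite unitary group, and generation enters only when the kernel is determined.\<close>

locale unitary_group =
  fixes d :: nat and G :: "complex mat set"
  assumes finite_G: "finite G"
    and unitary_G: "g \<in> G \<Longrightarrow> unitary d g"
    and subgroup_G: "subgroup G (GL d)"
begin

lemma G_carrier [simp]: "g \<in> G \<Longrightarrow> g \<in> carrier_mat d d"
  using unitary_G unitary_carrier by blast

lemma one_in_G [simp]: "1\<^sub>m d \<in> G"
  using subgroup.one_closed[OF subgroup_G] by simp

lemma mult_in_G [simp]: "g \<in> G \<Longrightarrow> h \<in> G \<Longrightarrow> g * h \<in> G"
  using subgroup.m_closed[OF subgroup_G] by simp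

abbreviation inv_GL ("inv\<^sub>G _" [81] 80) where "inv_GL g \<equiv> inv\<^bsub>GL d\<^esub> g"

lemma inv_in_G [simp]: "g \<in> G \<Longrightarrow> inv_GL g \<in> G"
  using subgroup.m_inv_closed[OF subgroup_G] .

lemma inv_mult_G [simp]: "g \<in> G \<Longrightarrow> inv_GL g * g = 1\<^sub>m d" "g \<in> G \<Longrightarrow> g * inv_GL g = 1\<^sub>m d"
  using group.l_inv[OF group_GL[of d], of g] group.r_inv[OF group_GL[of d], of g]
    subgroup.mem_carrier[OF subgroup_G, of g] by auto

lemma inv_mult_vec_G [simp]:
  assumes "g \<in> G" "v \<in> carrier_vec d"
  shows "inv_GL g *\<^sub>v (g *\<^sub>v v) = v"
  using assms assoc_mult_mat_vec[of "inv_GL g" d d g d v] by simp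

lemma mult_vec_eq_0_iff_G:
  assumes "g \<in> G" "v \<in> carrier_vec d"
  shows "g *\<^sub>v v = 0\<^sub>v d \<longleftrightarrow> v = 0\<^sub>v d"
proof -
  have 0: "h *\<^sub>v 0\<^sub>v d = 0\<^sub>v d" if "h \<in> G" for h
    using G_carrier[OF that] by (intro eq_vecI) auto
  show ?thesis
    using 0[OF assms(1)] 0[OF inv_in_G[OF assms(1)]] inv_mult_vec_G[OF assms] by metis
qed

section \<open>Roots and root subgroups described by the parameters of \<open>hrefl\<close>\<close>

lemma hrefl_in_G_nonzero:
  assumes "a \<in> carrier_vec d" "a \<noteq> 0\<^sub>v d" "hrefl d a z \<in> G"
  shows "z \<noteq> 0"
  using assms hrefl_in_GL_iff subgroup.mem_carrier[OF subgroup_G] by blast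

lemma roots_iff:
  "a \<in> roots d G \<longleftrightarrow> a \<in> carrier_vec d \<and> a \<noteq> 0\<^sub>v d \<and> (\<exists>z. z \<noteq> 1 \<and> hrefl d a z \<in> G)"
proof
  assume "a \<in> roots d G"
  then obtain g where g: "g \<in> G" "reflection d g" and r: "is_root d g a" by (auto simp: roots_def)
  obtain b z where b: "b \<in> carrier_vec d" "b \<noteq> 0\<^sub>v d" "z \<noteq> 0" "z \<noteq> 1" "g = hrefl d b z"
    using unitary_reflection_eq_hrefl[OF unitary_G[OF g(1)] g(2)] by blast
  with r obtain s where "s \<noteq> 0" "a = s \<cdot>\<^sub>v b" using is_root_hrefl by blast
  then have "hrefl d a z = g" using b hrefl_smult by simp
  then show "a \<in> carrier_vec d \<and> a \<noteq> 0\<^sub>v d \<and> (\<exists>z. z \<noteq> 1 \<and> hrefl d a z \<in> G)"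
    using r g(1) b(4) unfolding is_root_def by blast
next
  assume "a \<in> carrier_vec d \<and> a \<noteq> 0\<^sub>v d \<and> (\<exists>z. z \<noteq> 1 \<and> hrefl d a z \<in> G)"
  then obtain z where a: "a \<in> carrier_vec d" "a \<noteq> 0\<^sub>v d" and z: "z \<noteq> 1" "hrefl d a z \<in> G" by blast
  have "is_root d (hrefl d a z) a"
    using is_root_hrefl[OF a z(1)] a by (intro iffD2[OF is_root_hrefl[OF a z(1)]] exI[of _ 1]) auto
  then show "a \<in> roots d G"
    using reflection_hrefl[OF a hrefl_in_G_nonzero[OF a z(2)] z(1)] z(2) by (auto simp: roots_def)
qed

lemma reflection_in_G_iff:
  "g \<in> G \<and> reflection d g \<longleftrightarrow> (\<exists>a\<in>roots d G. \<exists>z. z \<noteq> 1 \<and> g = hrefl d a z \<and> g \<in> G)"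
proof
  assume g: "g \<in> G \<and> reflection d g"
  then obtain a z where a: "a \<in> carrier_vec d" "a \<noteq> 0\<^sub>v d" and z: "z \<noteq> 1" and eq: "g = hrefl d a z"
    using unitary_reflection_eq_hrefl[OF unitary_G[of g]] by blast
  have "a \<in> roots d G" using g a z by (auto simp: roots_iff eq)
  then show "\<exists>a\<in>roots d G. \<exists>z. z \<noteq> 1 \<and> g = hrefl d a z \<and> g \<in> G"
    using g z eq by blast
next
  assume "\<exists>a\<in>roots d G. \<exists>z. z \<noteq> 1 \<and> g = hrefl d a z \<and> g \<in> G"
  then obtain a z where "a \<in> roots d G" and z: "z \<noteq> 1" and g: "hrefl d a z \<in> G" "g = hrefl d a z" by blast
  then have a: "a \<in> carrier_vec d" "a \<noteq> 0\<^sub>v d" by (simp_all add: roots_iff)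
  show "g \<in> G \<and> reflection d g"
    using reflection_hrefl[OF a hrefl_in_G_nonzero[OF a g(1)] z] g by simp
qed

text \<open>The parameter z = 1 accounts for the identity, which the definition inserts separately;
  every other member has its root line spanned by a and can be rewritten with a itself as
  root.\<close>

lemma root_subgroup_eq:
  assumes a: "a \<in> carrier_vec d" "a \<noteq> 0\<^sub>v d"
  shows "root_subgroup d G a = {g \<in> G. \<exists>z. g = hrefl d a z}"
proof (intro equalityI subsetI)
  fix g assume g: "g \<in> root_subgroup d G a"
  show "g \<in> {g \<in> G. \<exists>z. g = hrefl d a z}"
  proof (cases "g = 1\<^sub>m d")
    case True
    then show ?thesis by (auto intro: exI[of _ 1])
  next
    case False
    with g have g: "g \<in> G" "reflection d g" and r: "is_root d g a" by (auto simp: root_subgroup_def)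
    obtain b z where b: "b \<in> carrier_vec d" "b \<noteq> 0\<^sub>v d" "z \<noteq> 0" "z \<noteq> 1" "g = hrefl d b z"
      using unitary_reflection_eq_hrefl[OF unitary_G[OF g(1)] g(2)] by blast
    with r obtain s where "s \<noteq> 0" "a = s \<cdot>\<^sub>v b" using is_root_hrefl by blast
    then have "g = hrefl d a z" using b hrefl_smult by simp
    then show ?thesis using g by blast
  qed
next
  fix g assume "g \<in> {g \<in> G. \<exists>z. g = hrefl d a z}"
  then obtain z where g: "g \<in> G" "g = hrefl d a z" by blast
  show "g \<in> root_subgroup d G a"
  proof (cases "z = 1")
    case True
    then show ?thesis using g by (simp add: root_subgroup_def)
  next
    case False
    have "is_root d g a"
      unfolding g(2) by (intro iffD2[OF is_root_hrefl[OF a False]] exI[of _ 1]) auto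
    then show ?thesis
      using g reflection_hrefl[OF a hrefl_in_G_nonzero[OF a] False] by (auto simp: root_subgroup_def)
  qed
qed

lemma rootsD: "a \<in> roots d G \<Longrightarrow> a \<in> carrier_vec d" "a \<in> roots d G \<Longrightarrow> a \<noteq> 0\<^sub>v d"
  by (auto simp: roots_iff)

lemma smult_roots: "a \<in> roots d G \<Longrightarrow> s \<noteq> 0 \<Longrightarrow> s \<cdot>\<^sub>v a \<in> roots d G"
  by (auto simp: roots_iff hrefl_smult vec_eq_iff)

lemma root_subgroup_smult: "a \<in> roots d G \<Longrightarrow> s \<noteq> 0 \<Longrightarrow> root_subgroup d G (s \<cdot>\<^sub>v a) = root_subgroup d G a"
  using smult_roots[of a s] by (simp add: root_subgroup_eq rootsD hrefl_smult)

text \<open>Because a is a root, the common subgroup contains a nontrivial reflection, and this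
  determines the root line. Root subgroups can therefore stand for mirrors.\<close>

lemma root_subgroup_eq_imp_multiple:
  assumes a: "a \<in> roots d G" and b: "b \<in> carrier_vec d" "b \<noteq> 0\<^sub>v d"
    and eq: "root_subgroup d G a = root_subgroup d G b"
  shows "\<exists>s. s \<noteq> 0 \<and> b = s \<cdot>\<^sub>v a"
proof -
  obtain z where z: "z \<noteq> 1" "hrefl d a z \<in> G" using a by (auto simp: roots_iff)
  have "hrefl d a z \<in> root_subgroup d G b"
    using z a by (auto simp flip: eq simp: root_subgroup_eq rootsD)
  moreover have "hrefl d a z \<noteq> 1\<^sub>m d"
    using hrefl_eq_iff[of a d z 1] a z by (simp add: rootsD)
  ultimately have "is_root d (hrefl d a z) b" by (auto simp: root_subgroup_def)
  then show ?thesis using is_root_hrefl[of a d z b] a z by (simp add: rootsD)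
qed

section \<open>Conjugation of root subgroups as the action on roots\<close>

lemma hrefl_conj_G:
  assumes "g \<in> G" "a \<in> carrier_vec d"
  shows "g * hrefl d a z * inv_GL g = hrefl d (g *\<^sub>v a) z"
  using assms hrefl_conj[OF unitary_G, of g a z]
  by (simp add: assoc_mult_mat[of _ d d _ d _ d] right_mult_one_mat[of _ d d])

lemma hrefl_mult_vec_in_G_iff:
  assumes "g \<in> G" "a \<in> carrier_vec d"
  shows "hrefl d (g *\<^sub>v a) z \<in> G \<longleftrightarrow> hrefl d a z \<in> G"
proof
  assume "hrefl d (g *\<^sub>v a) z \<in> G"
  moreover have "inv_GL g * hrefl d (g *\<^sub>v a) z * inv_GL (inv_GL g) = hrefl d a z"
    using hrefl_conj_G[of "inv_GL g" "g *\<^sub>v a" z] assms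
    by (metis G_carrier inv_in_G inv_mult_vec_G mult_mat_vec_carrier)
  ultimately show "hrefl d a z \<in> G" using assms by (metis inv_in_G mult_in_G)
next
  assume "hrefl d a z \<in> G"
  then show "hrefl d (g *\<^sub>v a) z \<in> G" using hrefl_conj_G[OF assms, of z] assms
    by (metis inv_in_G mult_in_G)
qed

lemma mult_vec_roots: "g \<in> G \<Longrightarrow> a \<in> roots d G \<Longrightarrow> g *\<^sub>v a \<in> roots d G"
  using mult_mat_vec_carrier[OF G_carrier]
  by (auto simp: roots_iff hrefl_mult_vec_in_G_iff mult_vec_eq_0_iff_G)

lemma conj_root_subgroup:
  assumes g: "g \<in> G" and a: "a \<in> roots d G"
  shows "(g <#\<^bsub>GL d\<^esub> root_subgroup d G a) #>\<^bsub>GL d\<^esub> (inv\<^bsub>GL d\<^esub> g) = root_subgroup d G (g *\<^sub>v a)"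
proof -
  have R: "root_subgroup d G a = hrefl d a ` {z. hrefl d a z \<in> G}"
    unfolding root_subgroup_eq[OF rootsD[OF a]] by blast
  have "(g <#\<^bsub>GL d\<^esub> root_subgroup d G a) #>\<^bsub>GL d\<^esub> (inv\<^bsub>GL d\<^esub> g) =
      (\<lambda>h. g * h * inv_GL g) ` root_subgroup d G a"
    by (auto simp: l_coset_def r_coset_def)
  also have "\<dots> = hrefl d (g *\<^sub>v a) ` {z. hrefl d a z \<in> G}"
    unfolding R image_image hrefl_conj_G[OF g rootsD(1)[OF a]] ..
  also have "\<dots> = root_subgroup d G (g *\<^sub>v a)"
    unfolding root_subgroup_eq[OF rootsD[OF mult_vec_roots[OF g a]]]
      hrefl_mult_vec_in_G_iff[OF g rootsD(1)[OF a], symmetric] by blast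
  finally show ?thesis .
qed

lemma reflection_orbit_eq:
  "a \<in> roots d G \<Longrightarrow> reflection_orbit d G a = (\<lambda>g. root_subgroup d G (g *\<^sub>v a)) ` G"
  unfolding reflection_orbit_def by (rule image_cong) (auto simp: conj_root_subgroup)

lemma root_subgroup_in_orbit: "a \<in> roots d G \<Longrightarrow> root_subgroup d G a \<in> reflection_orbit d G a"
  by (auto simp: reflection_orbit_eq rootsD intro!: image_eqI[of _ _ "1\<^sub>m d"])

lemma reflection_orbit_mult_vec:
  assumes g: "g \<in> G" and a: "a \<in> roots d G"
  shows "reflection_orbit d G (g *\<^sub>v a) = reflection_orbit d G a"
proof -
  have sub: "reflection_orbit d G (h *\<^sub>v b) \<subseteq> reflection_orbit d G b" if hb: "h \<in> G" "b \<in> roots d G" for h b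
  proof
    fix H assume "H \<in> reflection_orbit d G (h *\<^sub>v b)"
    then obtain x where "x \<in> G" "H = root_subgroup d G (x *\<^sub>v (h *\<^sub>v b))"
      using reflection_orbit_eq[OF mult_vec_roots[OF hb]] by auto
    then have "x * h \<in> G" "H = root_subgroup d G ((x * h) *\<^sub>v b)"
      using that by (simp_all add: assoc_mult_mat_vec[of _ d d _ d] rootsD)
    then show "H \<in> reflection_orbit d G b"
      unfolding reflection_orbit_eq[OF that(2)] by (rule image_eqI[rotated])
  qed
  show ?thesis
    using sub[OF g a] sub[of "inv_GL g" "g *\<^sub>v a"] g a mult_vec_roots by (simp add: rootsD)
qed

lemma reflection_orbit_smult:
  assumes a: "a \<in> roots d G" and s: "s \<noteq> 0"
  shows "reflection_orbit d G (s \<cdot>\<^sub>v a) = reflection_orbit d G a"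
proof -
  have "root_subgroup d G (g *\<^sub>v (s \<cdot>\<^sub>v a)) = root_subgroup d G (g *\<^sub>v a)" if "g \<in> G" for g
    using that a s by (simp add: mult_mat_vec[of _ d d] rootsD root_subgroup_smult mult_vec_roots)
  then show ?thesis using smult_roots[OF a s] a by (simp add: reflection_orbit_eq)
qed

text \<open>Equal root subgroups have proportional roots, so membership in the orbit of a yields an
  element of G that carries a to b up to a scalar; neither the element nor the scalar changes the
  orbit.\<close>

lemma reflection_orbit_eqI:
  assumes a: "a \<in> roots d G" and b: "b \<in> roots d G"
    and "root_subgroup d G b \<in> reflection_orbit d G a"
  shows "\<exists>s g. s \<noteq> 0 \<and> g \<in> G \<and> b = s \<cdot>\<^sub>v (g *\<^sub>v a)"
    and "reflection_orbit d G b = reflection_orbit d G a"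
proof -
  obtain g where g: "g \<in> G" "root_subgroup d G b = root_subgroup d G (g *\<^sub>v a)"
    using assms(3) a by (auto simp: reflection_orbit_eq)
  then obtain s where s: "s \<noteq> 0" "b = s \<cdot>\<^sub>v (g *\<^sub>v a)"
    using root_subgroup_eq_imp_multiple[of "g *\<^sub>v a" b] mult_vec_roots[OF g(1) a] b by (auto simp: rootsD)
  then show "\<exists>s g. s \<noteq> 0 \<and> g \<in> G \<and> b = s \<cdot>\<^sub>v (g *\<^sub>v a)"
    using g by blast
  show "reflection_orbit d G b = reflection_orbit d G a"
    using s g a by (simp add: reflection_orbit_smult mult_vec_roots reflection_orbit_mult_vec)
qed

end

section \<open>The character of a reflection orbit\<close>

context unitary_group
begin

text \<open>As c is a multiple of \<open>g *\<^sub>v b\<close> and g preserves inner products, g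
  carries the form of one mirror to the form of the other. The factor t reflects the free choice of
  c on its line and does not depend on v.\<close>

lemma conj_action_unitary:
  assumes g: "g \<in> G" and b: "b \<in> roots d G" and c: "c \<in> roots d G"
    and eq: "root_subgroup d G c = root_subgroup d G (g *\<^sub>v b)"
  shows "\<exists>t. \<forall>v\<in>carrier_vec d. (g *\<^sub>v v) \<bullet>c c = t * (v \<bullet>c b)"
proof -
  obtain s where s: "c = s \<cdot>\<^sub>v (g *\<^sub>v b)"
    using root_subgroup_eq_imp_multiple[OF mult_vec_roots[OF g b], of c] eq c by (auto simp: rootsD)
  have "(g *\<^sub>v v) \<bullet>c c = cnj s * (v \<bullet>c b)" if v: "v \<in> carrier_vec d" for v
  proof -
    have "(g *\<^sub>v v) \<bullet>c c = cnj s * ((g *\<^sub>v v) \<bullet>c (g *\<^sub>v b))"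
      using G_carrier[OF g] v rootsD[OF b] by (simp add: s conjugate_smult_vec)
    then show ?thesis
      using unitary_cscalar[OF unitary_G[OF g] v rootsD(1)[OF b]] by simp
  qed
  then show ?thesis by blast
qed

text \<open>The character is the one by which \<open>G\<close> acts on the polynomial \<open>f\<close> given by the product of the
  linear forms defining the mirrors in the orbit. Its value on a reflection \<open>s\<close> is found by evaluating
  at a vector fixed by \<open>s\<close> that lies on none of the other mirrors.\<close>

lemma character_exists:
  assumes a: "a \<in> roots d G"
  shows "\<exists>orbit_char. (\<forall>g\<in>G. \<forall>h\<in>G. orbit_char (g * h) = orbit_char g * orbit_char h) \<and>
    (\<forall>b\<in>roots d G. \<forall>z. hrefl d b z \<in> G \<longrightarrow>
      orbit_char (hrefl d b z) = (if reflection_orbit d G b = reflection_orbit d G a then z else (1::complex)))"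
proof -
  define Orb where "Orb = reflection_orbit d G a"
  have fin: "finite Orb" unfolding Orb_def reflection_orbit_def using finite_G by simp
  \<comment> \<open>One root is chosen for each root subgroup, so that the product \<open>f\<close>
    below has one factor per mirror and not one per root.\<close>
  define rt where "rt H = (SOME b. b \<in> roots d G \<and> root_subgroup d G b = H)" for H
  have rt: "rt H \<in> roots d G" "root_subgroup d G (rt H) = H" if "H \<in> Orb" for H
  proof -
    have "\<exists>b. b \<in> roots d G \<and> root_subgroup d G b = H"
      using that mult_vec_roots[OF _ a] by (auto simp: Orb_def reflection_orbit_eq[OF a])
    from someI_ex[OF this] show "rt H \<in> roots d G" "root_subgroup d G (rt H) = H"
      by (simp_all add: rt_def)
  qed
  have orb: "reflection_orbit d G (rt H) = Orb" if "H \<in> Orb" for H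
    using reflection_orbit_eqI(2)[OF a rt(1)[OF that]] rt(2)[OF that] that by (simp add: Orb_def)
  define act where "act g H = root_subgroup d G (g *\<^sub>v rt H)" for g H
  have act_Orb: "act g H \<in> Orb" if "g \<in> G" "H \<in> Orb" for g H
    using orb[OF that(2)] that unfolding act_def by (auto simp: reflection_orbit_eq[OF rt(1)])
  have act_inj: "inj_on (act g) Orb" if g: "g \<in> G" for g
  proof (rule inj_onI)
    fix H K assume H: "H \<in> Orb" and K: "K \<in> Orb" and eq: "act g H = act g K"
    obtain s where s: "s \<noteq> 0" "g *\<^sub>v rt K = s \<cdot>\<^sub>v (g *\<^sub>v rt H)"
      using root_subgroup_eq_imp_multiple[OF mult_vec_roots[OF g rt(1)[OF H]], of "g *\<^sub>v rt K"]
        mult_vec_roots[OF g rt(1)[OF K]] eq by (auto simp: act_def rootsD)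
    have "inv_GL g *\<^sub>v (g *\<^sub>v rt K) = s \<cdot>\<^sub>v (inv_GL g *\<^sub>v (g *\<^sub>v rt H))"
      unfolding s(2) using g rootsD(1)[OF rt(1)[OF H]]
      by (intro mult_mat_vec[of _ d d]) (auto intro: mult_mat_vec_carrier[OF G_carrier])
    then have "rt K = s \<cdot>\<^sub>v rt H" using g rt(1)[OF H] rt(1)[OF K] by (simp add: rootsD)
    then show "H = K" using root_subgroup_smult[OF rt(1)[OF H] s(1)] rt(2) H K by metis
  qed
  define f where "f M v = (\<Prod>H\<in>M. v \<bullet>c rt H)" for M v
  \<comment> \<open>The set M is any invariant part of the orbit, because the statement is needed
    both for the whole orbit and for the orbit without the mirror of a given reflection. The
    constant is the product of the scalars by which g rescales the single forms.\<close>
  have semi: "\<exists>c. \<forall>v\<in>carrier_vec d. f M (g *\<^sub>v v) = c * f M v"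
    if g: "g \<in> G" and M: "M \<subseteq> Orb" "act g ` M \<subseteq> M" for g M
  proof -
    have "inj_on (act g) M" using act_inj[OF g] M(1) inj_on_subset by blast
    moreover have "finite M" using fin M(1) finite_subset by blast
    ultimately have bij: "bij_betw (act g) M M"
      using M(2) endo_inj_surj by (metis bij_betw_def)
    have "\<exists>t. \<forall>v\<in>carrier_vec d. (g *\<^sub>v v) \<bullet>c rt (act g H) = t * (v \<bullet>c rt H)" if "H \<in> M" for H
    proof (rule conj_action_unitary[OF g rt(1)])
      show "H \<in> Orb" using that M by blast
      show "rt (act g H) \<in> roots d G" "root_subgroup d G (rt (act g H)) = root_subgroup d G (g *\<^sub>v rt H)"
        using rt[OF act_Orb[OF g]] that M(1) by (auto simp: act_def)
    qed
    then obtain t where t: "\<And>H v. H \<in> M \<Longrightarrow> v \<in> carrier_vec d \<Longrightarrow> (g *\<^sub>v v) \<bullet>c rt (act g H) = t H * (v \<bullet>c rt H)"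
      by metis
    have "f M (g *\<^sub>v v) = prod t M * f M v" if v: "v \<in> carrier_vec d" for v
    proof -
      have "f M (g *\<^sub>v v) = (\<Prod>H\<in>M. (g *\<^sub>v v) \<bullet>c rt (act g H))"
        unfolding f_def by (rule prod.reindex_bij_betw[OF bij, symmetric])
      also have "\<dots> = (\<Prod>H\<in>M. t H * (v \<bullet>c rt H))"
        using t v by (intro prod.cong) auto
      finally show ?thesis by (simp add: prod.distrib f_def)
    qed
    then show ?thesis by blast
  qed
  have gen: "\<exists>v\<in>W. f M v \<noteq> 0"
    if "M \<subseteq> Orb" and "W \<subseteq> carrier_vec d" "0\<^sub>v d \<in> W"
      and "\<And>v w t. v \<in> W \<Longrightarrow> w \<in> W \<Longrightarrow> v + t \<cdot>\<^sub>v w \<in> W"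
      and "\<And>H. H \<in> M \<Longrightarrow> \<exists>w\<in>W. w \<bullet>c rt H \<noteq> 0" for M W
  proof -
    have "finite M" using that(1) fin finite_subset by blast
    then have "\<exists>v\<in>W. \<forall>H\<in>M. v \<bullet>c rt H \<noteq> 0"
      using that rootsD[OF rt(1)] by (intro generic_vector) auto
    then show ?thesis using \<open>finite M\<close> by (simp add: f_def)
  qed
  \<comment> \<open>At \<open>v0\<close> the full product does not vanish, so the scalar of
    \<open>semi\<close> can be read off there as a quotient.\<close>
  obtain v0 where v0: "v0 \<in> carrier_vec d" "f Orb v0 \<noteq> 0"
  proof -
    have "\<exists>w\<in>carrier_vec d. w \<bullet>c rt H \<noteq> 0" if "H \<in> Orb" for H
      using rootsD[OF rt(1)[OF that]] by (intro bexI[of _ "rt H"]) auto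
    then show thesis using gen[OF subset_refl, of "carrier_vec d"] that by auto
  qed
  define orbit_char where "orbit_char g = f Orb (g *\<^sub>v v0) / f Orb v0" for g
  have orbit_char: "f Orb (g *\<^sub>v v) = orbit_char g * f Orb v" if g: "g \<in> G" and v: "v \<in> carrier_vec d" for g v
  proof -
    obtain c where c: "\<And>v. v \<in> carrier_vec d \<Longrightarrow> f Orb (g *\<^sub>v v) = c * f Orb v"
      using semi[OF g subset_refl] act_Orb[OF g] by blast
    have "orbit_char g = c" using c[OF v0(1)] v0(2) by (simp add: orbit_char_def)
    then show ?thesis using c[OF v] by simp
  qed
  have hom: "orbit_char (g * h) = orbit_char g * orbit_char h" if g: "g \<in> G" and h: "h \<in> G" for g h
  proof -
    have "orbit_char (g * h) * f Orb v0 = f Orb ((g * h) *\<^sub>v v0)"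
      using orbit_char[OF mult_in_G[OF g h] v0(1)] by simp
    also have "\<dots> = f Orb (g *\<^sub>v (h *\<^sub>v v0))"
      using g h v0 by (simp add: assoc_mult_mat_vec[of _ d d _ d])
    also have "\<dots> = orbit_char g * (orbit_char h * f Orb v0)"
      using orbit_char[OF g, of "h *\<^sub>v v0"] orbit_char[OF h v0(1)] mult_mat_vec_carrier[OF G_carrier[OF h] v0(1)] by simp
    finally show ?thesis using v0(2) by simp
  qed
  have val: "orbit_char (hrefl d b z) = (if reflection_orbit d G b = Orb then z else 1)"
    if b: "b \<in> roots d G" and z: "hrefl d b z \<in> G" for b z
  proof (cases "z = 1")
    case True
    then show ?thesis using v0 by (simp add: orbit_char_def)
  next
    case False
    note bD = rootsD[OF b]
    define s where "s = hrefl d b z"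
    define H0 where "H0 = root_subgroup d G b"
    define W where "W = {v \<in> carrier_vec d. s *\<^sub>v v = v}"
    have W_iff: "v \<in> W \<longleftrightarrow> v \<in> carrier_vec d \<and> v \<bullet>c b = 0" for v
      using hrefl_fixes_iff[OF bD] False by (auto simp: W_def s_def)
    have s: "s \<in> G" using z by (simp add: s_def)
    \<comment> \<open>The mirror W of s lies in no other mirror of the orbit: otherwise the root of
      that mirror would be a multiple of b, and its root subgroup would be
      \<open>H0\<close>.\<close>
    have genW: "\<exists>v\<in>W. f (Orb - {H0}) v \<noteq> 0"
    proof (rule gen)
      show "W \<subseteq> carrier_vec d" "0\<^sub>v d \<in> W" using bD by (auto simp: W_iff)
      show "v + t \<cdot>\<^sub>v w \<in> W" if "v \<in> W" "w \<in> W" for v w t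
        using that bD by (auto simp: W_iff add_scalar_prod_distrib[of _ d])
      fix H assume H: "H \<in> Orb - {H0}"
      have "\<not> is_root d s (rt H)"
      proof
        assume "is_root d s (rt H)"
        then obtain t where "t \<noteq> 0" "rt H = t \<cdot>\<^sub>v b"
          using is_root_hrefl[OF bD False] by (auto simp: s_def)
        then have "H = H0" using rt(2)[of H] H root_subgroup_smult[OF b] by (auto simp: H0_def)
        with H show False by simp
      qed
      then show "\<exists>w\<in>W. w \<bullet>c rt H \<noteq> 0"
        using rootsD[OF rt(1), of H] H by (auto simp: is_root_def W_def)
    qed auto
    \<comment> \<open>Since s only rescales its own root, it fixes \<open>H0\<close> and by
      injectivity permutes the remaining members. The scalar that arises is 1, because s fixes the
      point of \<open>genW\<close> at which the remaining product is nonzero.\<close>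
    have fixf: "f (Orb - {H0}) (s *\<^sub>v v) = f (Orb - {H0}) v" if v: "v \<in> carrier_vec d" for v
    proof -
      have "act s ` (Orb - {H0}) \<subseteq> Orb - {H0}"
      proof (cases "H0 \<in> Orb")
        case True
        obtain t where t: "t \<noteq> 0" "rt H0 = t \<cdot>\<^sub>v b"
          using root_subgroup_eq_imp_multiple[OF b rootsD[OF rt(1)[OF True]]] rt(2)[OF True] H0_def by metis
        have "s *\<^sub>v rt H0 = z \<cdot>\<^sub>v rt H0"
          using hrefl_self[of "rt H0" d z] rootsD[OF rt(1)[OF True]] hrefl_smult[OF bD(1) t(1), of z] t(2)
          by (simp add: s_def)
        then have "act s H0 = H0"
          using root_subgroup_smult[OF rt(1)[OF True] hrefl_in_G_nonzero[OF bD z]] rt(2)[OF True]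
          by (simp add: act_def)
        then have "act s H \<noteq> H0" if "H \<in> Orb - {H0}" for H
          using inj_onD[OF act_inj[OF s], of H H0] that True by auto
        then show ?thesis using act_Orb[OF s] by auto
      next
        case False
        then show ?thesis using act_Orb[OF s] by auto
      qed
      from semi[OF s _ this] obtain c
        where c: "\<And>v. v \<in> carrier_vec d \<Longrightarrow> f (Orb - {H0}) (s *\<^sub>v v) = c * f (Orb - {H0}) v" by blast
      obtain w where "w \<in> W" "f (Orb - {H0}) w \<noteq> 0" using genW by blast
      then have "c = 1" using c[of w] by (simp add: W_def)
      then show ?thesis using c[OF v] by simp
    qed
    show ?thesis
    proof (cases "H0 \<in> Orb")
      case True
      obtain t where t: "t \<noteq> 0" "rt H0 = t \<cdot>\<^sub>v b"
        using root_subgroup_eq_imp_multiple[OF b rootsD[OF rt(1)[OF True]]] rt(2)[OF True] H0_def by metis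
      \<comment> \<open>Only the factor of the mirror of s itself is rescaled, by z; the rest is
        invariant by \<open>fixf\<close>.\<close>
      have split: "f Orb v = (v \<bullet>c rt H0) * f (Orb - {H0}) v" for v
        unfolding f_def by (rule prod.remove[OF fin True])
      have "f Orb (s *\<^sub>v v0) = z * f Orb v0"
        using hrefl_cscalar[of "rt H0" d v0 z] rootsD[OF rt(1)[OF True]] hrefl_smult[OF bD(1) t(1), of z] t(2) v0(1)
        unfolding split by (simp add: fixf flip: s_def)
      then have "orbit_char s = z" using v0(2) by (simp add: orbit_char_def)
      moreover have "reflection_orbit d G b = Orb"
        using reflection_orbit_eqI(2)[OF a b] True by (simp add: H0_def Orb_def)
      ultimately show ?thesis by (simp add: s_def)
    next
      case False
      \<comment> \<open>Here \<open>Orb - {H0}\<close> is \<open>Orb\<close>, so \<open>fixf\<close>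
        speaks of the full product.\<close>
      then have "orbit_char s = 1" using fixf[OF v0(1)] v0(2) by (simp add: orbit_char_def)
      moreover have "reflection_orbit d G b \<noteq> Orb"
        using root_subgroup_in_orbit[OF b] False by (auto simp: H0_def)
      ultimately show ?thesis by (simp add: s_def)
    qed
  qed
  show ?thesis using hom val unfolding Orb_def by blast
qed

end

section \<open>Reflection type and characters\<close>

text \<open>Multiplication by a member z permutes Z, so the product over Z is unchanged by the
  factor \<open>z ^ card Z\<close>, which must be 1. There are exactly \<open>card Z\<close> such
  roots of unity, so Z contains all of them.\<close>

lemma finite_mult_closed_eq_roots_of_unity:
  fixes Z :: "complex set"
  assumes fin: "finite Z" and "1 \<in> Z" "0 \<notin> Z" and closed: "\<And>z y. z \<in> Z \<Longrightarrow> y \<in> Z \<Longrightarrow> z * y \<in> Z"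
  shows "Z = {z. z ^ card Z = 1}"
proof (rule card_subset_eq)
  have pos: "card Z > 0" using assms(1,2) by (auto simp: card_gt_0_iff)
  show "finite {z::complex. z ^ card Z = 1}" using finite_roots_unity[of "card Z"] pos by simp
  show "card Z = card {z::complex. z ^ card Z = 1}" using card_roots_unity_eq[OF pos] by simp
  show "Z \<subseteq> {z. z ^ card Z = 1}"
  proof
    fix z assume z: "z \<in> Z"
    with \<open>0 \<notin> Z\<close> have "inj_on ((*) z) Z" by (auto simp: inj_on_def)
    moreover have "(*) z ` Z \<subseteq> Z" using closed z by auto
    ultimately have bij: "bij_betw ((*) z) Z Z"
      using endo_inj_surj[OF fin] by (simp add: bij_betw_def)
    have "\<Prod>Z = (\<Prod>y\<in>Z. z * y)"
      by (rule prod.reindex_bij_betw[OF bij, symmetric])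
    also have "\<dots> = z ^ card Z * \<Prod>Z" by (simp add: prod.distrib)
    finally show "z \<in> {z. z ^ card Z = 1}" using fin \<open>0 \<notin> Z\<close> by simp
  qed
qed

text \<open>The discrete logarithm to the base exp(2 \<pi> i / k), the primitive root used in
  \<open>diagonal_action\<close>; the range 0, ..., k - 1 is the carrier of
  \<open>integer_mod_group k\<close>. It is meaningful for k > 0 and
  \<open>w ^ k = 1\<close>.\<close>

definition unity_log :: "nat \<Rightarrow> complex \<Rightarrow> int" where
  "unity_log k w = (THE x. 0 \<le> x \<and> x < int k \<and> cis (2 * pi * of_int x / of_nat k) = w)"

lemma unity_log_ex1:
  assumes k: "k > 0" and w: "w ^ k = 1"
  shows "\<exists>!x. 0 \<le> x \<and> x < int k \<and> cis (2 * pi * of_int x / of_nat k) = w"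
proof -
  have bij: "bij_betw (\<lambda>j. cis (2 * pi * real j / real k)) {..<k} {z. z ^ k = 1}"
    by (rule bij_betw_roots_unity[OF k])
  then obtain j where "j < k" "cis (2 * pi * real j / real k) = w"
    using w unfolding bij_betw_def by (metis (mono_tags, lifting) imageE lessThan_iff mem_Collect_eq)
  then have "0 \<le> int j \<and> int j < int k \<and> cis (2 * pi * of_int (int j) / of_nat k) = w" by simp
  moreover have "x = y" if xy: "0 \<le> x \<and> x < int k \<and> cis (2 * pi * of_int x / of_nat k) = w"
    "0 \<le> y \<and> y < int k \<and> cis (2 * pi * of_int y / of_nat k) = w" for x y
  proof -
    obtain i j where ij: "x = int i" "y = int j"
      using xy by (metis nonneg_int_cases)
    then show ?thesis
      using xy inj_onD[OF bij_betw_imp_inj_on[OF bij], of i j] by simp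
  qed
  ultimately show ?thesis by blast
qed

lemma unity_log:
  assumes "k > 0" "w ^ k = 1"
  shows "unity_log k w \<in> {0..<int k}" "cis (2 * pi * of_int (unity_log k w) / of_nat k) = w"
  using theI'[OF unity_log_ex1[OF assms]] by (simp_all add: unity_log_def)

lemma unity_log_eqI:
  assumes k: "k > 0" and x: "x \<in> {0..<int k}" and w: "cis (2 * pi * of_int x / of_nat k) = w"
  shows "unity_log k w = x"
proof -
  have "w ^ k = cis (2 * pi * of_int x)" unfolding w[symmetric] DeMoivre using k by simp
  then have "w ^ k = 1" using cis_multiple_2pi[of "of_int x"] by simp
  from the1_equality[OF unity_log_ex1[OF k this]] show ?thesis
    using x w by (simp add: unity_log_def)
qed

lemma unity_log_1 [simp]: "k > 0 \<Longrightarrow> unity_log k 1 = 0"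
  by (rule unity_log_eqI) auto

lemma unity_log_eq_0_iff: "k > 0 \<Longrightarrow> w ^ k = 1 \<Longrightarrow> unity_log k w = 0 \<longleftrightarrow> w = 1"
  using unity_log(2)[of k w] by auto

lemma unity_log_mult:
  assumes k: "k > 0" and w: "w ^ k = 1" and v: "v ^ k = 1"
  shows "unity_log k (w * v) = (unity_log k w + unity_log k v) mod int k"
proof (rule unity_log_eqI[OF k])
  define x where "x = unity_log k w + unity_log k v"
  have "x = int k * (x div int k) + x mod int k" by simp
  then have "of_int x = of_nat k * of_int (x div int k) + (of_int (x mod int k) :: real)"
    by (metis of_int_add of_int_mult of_int_of_nat_eq)
  then have "2 * pi * of_int x / of_nat k =
      2 * pi * of_int (x div int k) + 2 * pi * of_int (x mod int k) / of_nat k"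
    using k by (simp add: field_simps)
  then have "cis (2 * pi * of_int x / of_nat k) = cis (2 * pi * of_int (x mod int k) / of_nat k)"
    using cis_multiple_2pi[of "of_int (x div int k)"] by (simp flip: cis_mult)
  moreover have "cis (2 * pi * of_int x / of_nat k) = w * v"
    using unity_log(2)[OF k w] unity_log(2)[OF k v]
    by (simp add: x_def distrib_left add_divide_distrib flip: cis_mult)
  ultimately show "cis (2 * pi * of_int ((unity_log k w + unity_log k v) mod int k) / of_nat k) = w * v"
    by (simp add: x_def)
qed (use k in auto)

locale reflection_group_type = unitary_group +
  fixes m :: nat and a :: "nat \<Rightarrow> complex vec" and n k :: "nat \<Rightarrow> nat"
  assumes generated: "\<exists>S \<subseteq> Collect (reflection d). G = generate (GL d) S"
    and type: "has_reflection_type d G m a n k"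
begin

section \<open>Reflections compared with the representatives of their orbits\<close>

lemma a_roots: "j < m \<Longrightarrow> a j \<in> roots d G"
  using type by (auto simp: has_reflection_type_def)

lemma orbit_a_eq_iff: "i < m \<Longrightarrow> j < m \<Longrightarrow> reflection_orbit d G (a i) = reflection_orbit d G (a j) \<longleftrightarrow> i = j"
  using type by (auto simp: has_reflection_type_def bij_betw_def inj_on_def)

lemma orbit_cover:
  assumes "b \<in> roots d G"
  obtains j where "j < m" "reflection_orbit d G b = reflection_orbit d G (a j)"
proof -
  have "reflection_orbit d G b \<in> (\<lambda>j. reflection_orbit d G (a j)) ` {..<m}"
    using type assms by (auto simp: has_reflection_type_def bij_betw_def)
  then show thesis using that by auto
qed

text \<open>The admissible parameters form a finite set closed under multiplication, hence a full
  group of roots of unity. Its size is \<open>k j\<close>, because distinct parameters give distinct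
  matrices.\<close>

lemma root_subgroup_a:
  assumes j: "j < m"
  shows "k j > 0" "hrefl d (a j) z \<in> G \<longleftrightarrow> z ^ k j = 1"
proof -
  note aj = rootsD[OF a_roots[OF j]]
  define Z where "Z = {z. hrefl d (a j) z \<in> G}"
  have img: "root_subgroup d G (a j) = hrefl d (a j) ` Z"
    unfolding root_subgroup_eq[OF aj] Z_def by blast
  have inj: "inj_on (hrefl d (a j)) Z" using hrefl_eq_iff[OF aj] by (auto simp: inj_on_def)
  have "hrefl d (a j) ` Z \<subseteq> G" by (auto simp: Z_def)
  then have fin: "finite Z" using inj finite_G by (metis finite_imageD finite_subset)
  have k: "k j = card Z"
    using type j card_image[OF inj] by (simp add: has_reflection_type_def img)
  have one: "1 \<in> Z" by (simp add: Z_def)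
  then show "k j > 0" using fin k by (auto simp: card_gt_0_iff)
  have "Z = {z. z ^ card Z = 1}"
    using hrefl_in_G_nonzero[OF aj] mult_in_G
    by (intro finite_mult_closed_eq_roots_of_unity fin one) (auto simp: Z_def simp flip: hrefl_mult[OF aj])
  then have "z \<in> Z \<longleftrightarrow> z ^ card Z = 1" by blast
  then show "hrefl d (a j) z \<in> G \<longleftrightarrow> z ^ k j = 1" by (simp add: k Z_def)
qed

text \<open>One g serves all z, since b is a multiple of \<open>g *\<^sub>v a j\<close>. The
  condition on the parameters thus passes from \<open>a j\<close> to every root in its
  orbit.\<close>

lemma hrefl_conjugate:
  assumes b: "b \<in> roots d G" and j: "j < m" and orb: "reflection_orbit d G b = reflection_orbit d G (a j)"
  obtains g where "g \<in> G" "\<And>z. hrefl d b z = g * hrefl d (a j) z * inv_GL g"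
    "\<And>z. hrefl d b z \<in> G \<longleftrightarrow> z ^ k j = 1"
proof -
  note aj = a_roots[OF j]
  obtain s g where s: "s \<noteq> 0" "g \<in> G" "b = s \<cdot>\<^sub>v (g *\<^sub>v a j)"
    using reflection_orbit_eqI(1)[OF aj b] root_subgroup_in_orbit[OF b] orb by blast
  then have eq: "hrefl d b z = hrefl d (g *\<^sub>v a j) z" for z
    using rootsD(1)[OF mult_vec_roots[OF s(2) aj]] hrefl_smult by simp
  show thesis
    using that[OF s(2)] eq hrefl_conj_G[OF s(2) rootsD(1)[OF aj]]
      hrefl_mult_vec_in_G_iff[OF s(2) rootsD(1)[OF aj]] root_subgroup_a(2)[OF j] by metis
qed

text \<open>The inverse of a generator is again some \<open>hrefl\<close> with the same root and
  inverse parameter, so inverses need no case of their own.\<close>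

lemma reflection_induct [consumes 1, case_names one refl mult]:
  assumes "g \<in> G" and one: "P (1\<^sub>m d)"
    and refl: "\<And>b z. b \<in> roots d G \<Longrightarrow> hrefl d b z \<in> G \<Longrightarrow> P (hrefl d b z)"
    and mult: "\<And>g h. g \<in> G \<Longrightarrow> h \<in> G \<Longrightarrow> P g \<Longrightarrow> P h \<Longrightarrow> P (g * h)"
  shows "P g"
proof -
  obtain S where S: "S \<subseteq> Collect (reflection d)" "G = generate (GL d) S"
    using generated by blast
  have SG: "h \<in> G" if "h \<in> S" for h using that S(2) generate.incl by metis
  have "g \<in> generate (GL d) S" using assms(1) S(2) by simp
  then have "g \<in> G \<and> P g"
  proof (induction)
    case one
    then show ?case using assms(2) by simp
  next
    case (incl h)
    then show ?case
      using SG[OF incl] S(1) reflection_in_G_iff[of h] refl by (metis mem_Collect_eq subsetD)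
  next
    case (inv h)
    have hG: "h \<in> G" using SG[OF inv] .
    then obtain b z where b: "b \<in> roots d G" "h = hrefl d b z"
      using S(1) inv reflection_in_G_iff[of h] by blast
    have z: "z \<noteq> 0" using hrefl_in_G_nonzero rootsD[OF b(1)] hG b(2) by blast
    have "inv\<^bsub>GL d\<^esub> h = hrefl d b (inverse z)"
      using z rootsD[OF b(1)] hrefl_in_GL_iff
      by (intro group.inv_equality[OF group_GL]) (auto simp: b(2) hrefl_mult)
    then show ?case using refl[OF b(1), of "inverse z"] inv_in_G[OF hG] by simp
  next
    case (eng g h)
    then show ?case using mult by simp
  qed
  then show ?thesis ..
qed

definition orbit_char :: "nat \<Rightarrow> complex mat \<Rightarrow> complex" where
  "orbit_char j = (SOME \<chi>. (\<forall>g\<in>G. \<forall>h\<in>G. \<chi> (g * h) = \<chi> g * \<chi> h) \<and>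
    (\<forall>b\<in>roots d G. \<forall>z. hrefl d b z \<in> G \<longrightarrow>
      \<chi> (hrefl d b z) = (if reflection_orbit d G b = reflection_orbit d G (a j) then z else 1)))"

lemma
  assumes j: "j < m"
  shows orbit_char_mult: "g \<in> G \<Longrightarrow> h \<in> G \<Longrightarrow> orbit_char j (g * h) = orbit_char j g * orbit_char j h"
    and orbit_char_hrefl: "b \<in> roots d G \<Longrightarrow> hrefl d b z \<in> G \<Longrightarrow>
      orbit_char j (hrefl d b z) = (if reflection_orbit d G b = reflection_orbit d G (a j) then z else 1)"
  using someI_ex[OF character_exists[OF a_roots[OF j]]] by (auto simp: orbit_char_def)

lemma orbit_char_hrefl_in_orbit:
  assumes i: "i < m" and j: "j < m" and b: "b \<in> roots d G" "hrefl d b z \<in> G"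
    and orb: "reflection_orbit d G b = reflection_orbit d G (a i)"
  shows "orbit_char j (hrefl d b z) = (if j = i then z else 1)"
  using orbit_char_hrefl[OF j b] orbit_a_eq_iff[OF i j] orb by auto

lemma orbit_char_one [simp]: "j < m \<Longrightarrow> orbit_char j (1\<^sub>m d) = 1"
  using orbit_char_hrefl[of j "a j" 1] a_roots by simp

text \<open>On reflections the value is 1 or an admissible parameter of the orbit, and the property
  passes to products. This makes \<open>unity_log (k j)\<close> applicable on all of G.\<close>

lemma orbit_char_power:
  assumes g: "g \<in> G" and j: "j < m"
  shows "orbit_char j g ^ k j = 1"
  using g
proof (induction rule: reflection_induct)
  case (refl b z)
  show ?case
  proof (cases "reflection_orbit d G b = reflection_orbit d G (a j)")
    case True
    then show ?thesis using hrefl_conjugate[OF refl(1) j True] orbit_char_hrefl[OF j refl] refl(2) by metis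
  next
    case False
    then show ?thesis using orbit_char_hrefl[OF j refl] by simp
  qed
qed (use j in \<open>auto simp: orbit_char_mult power_mult_distrib\<close>)

lemma orbit_char_inv: "j < m \<Longrightarrow> g \<in> G \<Longrightarrow> orbit_char j (inv_GL g) * orbit_char j g = 1"
  using orbit_char_mult[of j "inv_GL g" g] by simp

end

section \<open>The abelianisation\<close>

text \<open>An order is determined by the exponents that give the identity, which allows a
  comparison across different groups.\<close>

lemma ord_eqI:
  assumes "group H" "group K" "x \<in> carrier H" "y \<in> carrier K"
    and eq: "\<And>n. x [^]\<^bsub>H\<^esub> (n::nat) = \<one>\<^bsub>H\<^esub> \<longleftrightarrow> y [^]\<^bsub>K\<^esub> n = \<one>\<^bsub>K\<^esub>"
  shows "group.ord H x = group.ord K y"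
  by (rule iffD2[OF group.ord_unique[OF assms(1,3)]])
    (simp add: eq group.pow_eq_id[OF assms(2,4)])

text \<open>Stated for an arbitrary structure with matrix multiplication, so that it covers both G
  and \<open>GL m\<close>.\<close>

lemma hrefl_pow:
  fixes H (structure)
  assumes "monoid.mult H = (*)" "one H = 1\<^sub>m d" and b: "b \<in> carrier_vec d" "b \<noteq> 0\<^sub>v d"
  shows "hrefl d b z [^]\<^bsub>H\<^esub> (n::nat) = hrefl d b (z ^ n)"
  by (induction n) (simp_all add: assms(1,2) hrefl_mult[OF b] mult.commute)

context reflection_group_type
begin

abbreviation "grp \<equiv> as_group d G"
abbreviation "ab \<equiv> abelianisation grp"
abbreviation "\<pi> \<equiv> abelianisation_map grp"

section \<open>The quotient by the commutator subgroup\<close>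

lemma group_grp: "group grp"
  using subgroup.subgroup_is_group[OF subgroup_G group_GL] .

lemma grp_inv: "g \<in> G \<Longrightarrow> inv\<^bsub>grp\<^esub> g = inv_GL g"
  using group.m_inv_consistent[OF group_GL subgroup_G] by simp

lemma derived_normal: "derived grp G \<lhd> grp"
  using group.derived_self_is_normal[OF group_grp] by simp

lemma comm_group_ab: "comm_group ab"
  using group.derived_quot_is_comm_group[OF group_grp] by (simp add: abelianisation_def)

lemma ab_hom: "group_hom grp ab \<pi>"
proof (intro group_hom.intro group_hom_axioms.intro group_grp comm_group.axioms(2)[OF comm_group_ab])
  have "carrier grp = G" by simp
  then show "\<pi> \<in> hom grp ab"
    unfolding abelianisation_def abelianisation_map_def[abs_def]
    using normal.r_coset_hom_Mod[OF derived_normal] by (simp only:)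
qed

lemma ab_map_carrier [simp]: "g \<in> G \<Longrightarrow> \<pi> g \<in> carrier ab"
  using group_hom.hom_closed[OF ab_hom] by simp

lemma ab_map_mult: "g \<in> G \<Longrightarrow> h \<in> G \<Longrightarrow> \<pi> (g * h) = \<pi> g \<otimes>\<^bsub>ab\<^esub> \<pi> h"
  using group_hom.hom_mult[OF ab_hom] by simp

lemma ab_map_one: "\<pi> (1\<^sub>m d) = \<one>\<^bsub>ab\<^esub>"
  using group_hom.hom_one[OF ab_hom] by simp

lemma ab_map_eq_one_iff: "g \<in> G \<Longrightarrow> \<pi> g = \<one>\<^bsub>ab\<^esub> \<longleftrightarrow> g \<in> derived grp G"
  using group.coset_join1[OF group_grp, of "derived grp G" g]
    group.coset_join2[OF group_grp, of g "derived grp G"] normal_imp_subgroup[OF derived_normal]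
  by (auto simp: abelianisation_def abelianisation_map_def FactGroup_def)

text \<open>In a commutative quotient the images of g and its inverse cancel. A reflection may
  therefore be replaced there by a conjugate whose root is one of the \<open>a j\<close>.\<close>

lemma ab_map_conj:
  assumes g: "g \<in> G" and h: "h \<in> G"
  shows "\<pi> (g * h * inv_GL g) = \<pi> h"
proof -
  interpret ab: comm_group ab by (rule comm_group_ab)
  have "\<pi> (g * h * inv_GL g) = \<pi> h \<otimes>\<^bsub>ab\<^esub> (\<pi> g \<otimes>\<^bsub>ab\<^esub> \<pi> (inv_GL g))"
    using g h by (simp add: ab_map_mult ab.m_ac)
  also have "\<pi> g \<otimes>\<^bsub>ab\<^esub> \<pi> (inv_GL g) = \<one>\<^bsub>ab\<^esub>"
    using g by (simp add: ab_map_one flip: ab_map_mult)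
  finally show ?thesis using h by simp
qed

lemma hrefl_a_in_G: "j < m \<Longrightarrow> g \<in> G \<Longrightarrow> hrefl d (a j) (orbit_char j g) \<in> G"
  by (simp add: root_subgroup_a(2) orbit_char_power)

text \<open>Both sides are homomorphisms in \<open>g\<close> that agree on reflections, so the characters
  determine the image of \<open>g\<close> in the abelianisation.\<close>

lemma ab_map_eq_finprod:
  assumes "g \<in> G"
  shows "\<pi> g = finprod ab (\<lambda>j. \<pi> (hrefl d (a j) (orbit_char j g))) {..<m}"
  using assms
proof (induction rule: reflection_induct)
  case one
  interpret ab: comm_group ab by (rule comm_group_ab)
  have "finprod ab (\<lambda>j. \<pi> (hrefl d (a j) (orbit_char j (1\<^sub>m d)))) {..<m} = \<one>\<^bsub>ab\<^esub>"
    by (rule ab.finprod_one_eqI) (simp add: ab_map_one)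
  then show ?case by (simp add: ab_map_one)
next
  case (refl b z)
  interpret ab: comm_group ab by (rule comm_group_ab)
  obtain i where i: "i < m" and orb: "reflection_orbit d G b = reflection_orbit d G (a i)"
    using orbit_cover[OF refl(1)] by blast
  obtain g where g: "g \<in> G" "hrefl d b z = g * hrefl d (a i) z * inv_GL g"
    and z: "z ^ k i = 1"
    using hrefl_conjugate[OF refl(1) i orb] refl(2) by metis
  have az: "hrefl d (a i) z \<in> G" using root_subgroup_a(2)[OF i] z by simp
  \<comment> \<open>Every character except the i-th is 1 on this reflection, so a single factor
    survives; it differs from the reflection by a conjugation only.\<close>
  have "finprod ab (\<lambda>j. \<pi> (hrefl d (a j) (orbit_char j (hrefl d b z)))) {..<m} =
      finprod ab (\<lambda>j. if i = j then \<pi> (hrefl d (a i) z) else \<one>\<^bsub>ab\<^esub>) {..<m}"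
    using i az by (intro ab.finprod_cong') (auto simp: orbit_char_hrefl_in_orbit[OF i _ refl orb] ab_map_one)
  also have "\<dots> = \<pi> (hrefl d (a i) z)"
    using i az by (intro ab.finprod_singleton[of i "{..<m}" "\<lambda>_. \<pi> (hrefl d (a i) z)"]) auto
  also have "\<dots> = \<pi> (hrefl d b z)"
    using ab_map_conj[OF g(1) az] g(2) by simp
  finally show ?case by simp
next
  case (mult g h)
  interpret ab: comm_group ab by (rule comm_group_ab)
  \<comment> \<open>Multiplicativity of the characters, and of \<open>hrefl\<close> in its
    parameter, splits each factor; commutativity then separates the two products.\<close>
  have "finprod ab (\<lambda>j. \<pi> (hrefl d (a j) (orbit_char j (g * h)))) {..<m} =
      finprod ab (\<lambda>j. \<pi> (hrefl d (a j) (orbit_char j g)) \<otimes>\<^bsub>ab\<^esub> \<pi> (hrefl d (a j) (orbit_char j h))) {..<m}"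
    using mult hrefl_a_in_G
    by (intro ab.finprod_cong')
      (auto simp: orbit_char_mult rootsD[OF a_roots] simp flip: ab_map_mult hrefl_mult)
  also have "\<dots> = \<pi> (g * h)"
    using mult hrefl_a_in_G by (simp add: ab_map_mult)
  finally show ?case by simp
qed

text \<open>Characters have commutative values and so kill commutators. Conversely, if all values
  are 1, then every factor in \<open>ab_map_eq_finprod\<close> is the image of the identity.\<close>

lemma derived_iff_ch:
  assumes g: "g \<in> G"
  shows "g \<in> derived grp G \<longleftrightarrow> (\<forall>j<m. orbit_char j g = 1)"
proof
  have sub: "subgroup {g \<in> G. \<forall>j<m. orbit_char j g = 1} grp"
  proof (rule group.subgroupI[OF group_grp])
    show "{g \<in> G. \<forall>j<m. orbit_char j g = 1} \<noteq> {}" using one_in_G by (auto intro!: exI[of _ "1\<^sub>m d"])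
    show "inv\<^bsub>grp\<^esub> h \<in> {g \<in> G. \<forall>j<m. orbit_char j g = 1}" if "h \<in> {g \<in> G. \<forall>j<m. orbit_char j g = 1}" for h
      using that orbit_char_inv[of _ h] by (auto simp: grp_inv)
  qed (auto simp: orbit_char_mult)
  have "derived_set grp G \<subseteq> {g \<in> G. \<forall>j<m. orbit_char j g = 1}"
  proof
    fix x assume "x \<in> derived_set grp G"
    then obtain g h where gh: "g \<in> G" "h \<in> G" "x = g * h * inv_GL g * inv_GL h"
      by (auto simp: grp_inv)
    have "orbit_char j x = 1" if j: "j < m" for j
    proof -
      have "orbit_char j x = (orbit_char j (inv_GL g) * orbit_char j g) * (orbit_char j (inv_GL h) * orbit_char j h)"
        using gh j by (simp add: orbit_char_mult)
      then show ?thesis using orbit_char_inv[OF j] gh by simp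
    qed
    then show "x \<in> {g \<in> G. \<forall>j<m. orbit_char j g = 1}" using gh by simp
  qed
  then have "derived grp G \<subseteq> {g \<in> G. \<forall>j<m. orbit_char j g = 1}"
    unfolding derived_def by (rule group.generate_subgroup_incl[OF group_grp _ sub])
  then show "g \<in> derived grp G \<Longrightarrow> \<forall>j<m. orbit_char j g = 1" by blast
next
  interpret ab: comm_group ab by (rule comm_group_ab)
  assume "\<forall>j<m. orbit_char j g = 1"
  then have "\<pi> g = \<one>\<^bsub>ab\<^esub>"
    unfolding ab_map_eq_finprod[OF g] by (intro ab.finprod_one_eqI) (simp add: ab_map_one)
  then show "g \<in> derived grp G" using ab_map_eq_one_iff[OF g] by simp
qed

section \<open>Logarithms of the characters as coordinates in the product of cyclic groups\<close>

definition \<Phi> :: "complex mat \<Rightarrow> nat \<Rightarrow> int" where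
  "\<Phi> g = (\<lambda>j\<in>{..<m}. unity_log (k j) (orbit_char j g))"

lemma carrier_cyclic_product: "carrier (cyclic_product m k) = (\<Pi>\<^sub>E j\<in>{..<m}. {0..<int (k j)})"
  unfolding cyclic_product_def carrier_product_group
  by (rule PiE_cong) (use root_subgroup_a(1) in \<open>auto simp: carrier_integer_mod_group\<close>)

lemma group_cyclic_product: "group (cyclic_product m k)"
  by (simp add: cyclic_product_def)

lemma \<Phi>_hom: "group_hom grp (cyclic_product m k) \<Phi>"
proof (intro group_hom.intro group_grp group_cyclic_product group_hom_axioms.intro homI)
  fix g assume "g \<in> carrier grp"
  then show "\<Phi> g \<in> carrier (cyclic_product m k)"
    using unity_log(1)[OF root_subgroup_a(1) orbit_char_power] by (auto simp: carrier_cyclic_product \<Phi>_def)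
next
  fix g h assume gh: "g \<in> carrier grp" "h \<in> carrier grp"
  then show "\<Phi> (g \<otimes>\<^bsub>grp\<^esub> h) = \<Phi> g \<otimes>\<^bsub>cyclic_product m k\<^esub> \<Phi> h"
    by (auto simp: \<Phi>_def cyclic_product_def orbit_char_mult unity_log_mult root_subgroup_a(1) orbit_char_power intro!: restrict_ext)
qed

lemma \<Phi>_kernel: "kernel grp (cyclic_product m k) \<Phi> = derived grp G"
proof -
  have sub: "derived grp G \<subseteq> G"
    using subgroup.subset[OF normal_imp_subgroup[OF derived_normal]] by simp
  have "\<Phi> g = \<one>\<^bsub>cyclic_product m k\<^esub> \<longleftrightarrow> g \<in> derived grp G" if g: "g \<in> G" for g
  proof -
    have "\<Phi> g = \<one>\<^bsub>cyclic_product m k\<^esub> \<longleftrightarrow> (\<forall>j<m. unity_log (k j) (orbit_char j g) = 0)"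
      by (auto simp: \<Phi>_def cyclic_product_def fun_eq_iff restrict_def)
    then show ?thesis
      by (simp add: derived_iff_ch[OF g] unity_log_eq_0_iff root_subgroup_a(1) orbit_char_power[OF g])
  qed
  with sub show ?thesis by (auto simp: kernel_def)
qed

lemma orbit_char_surj:
  assumes w: "\<And>j. j < m \<Longrightarrow> w j ^ k j = 1"
  shows "\<exists>g\<in>G. \<forall>j<m. orbit_char j g = w j"
proof -
  have "\<exists>g\<in>G. \<forall>j<m. orbit_char j g = (if j < l then w j else 1)" if "l \<le> m" for l
    using that
  proof (induction l)
    case 0
    then show ?case by (intro bexI[of _ "1\<^sub>m d"]) auto
  next
    case (Suc l)
    then obtain g where g: "g \<in> G" "\<forall>j<m. orbit_char j g = (if j < l then w j else 1)" by auto
    have l: "l < m" using Suc.prems by simp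
    have h: "hrefl d (a l) (w l) \<in> G" using root_subgroup_a(2)[OF l] w[OF l] by simp
    have "orbit_char j (g * hrefl d (a l) (w l)) = (if j < Suc l then w j else 1)" if j: "j < m" for j
      using g j orbit_char_hrefl_in_orbit[OF l j a_roots[OF l] h] h by (auto simp: orbit_char_mult)
    then show ?case using mult_in_G[OF g(1) h] by blast
  qed
  from this[OF order_refl] show ?thesis by auto
qed

lemma \<Phi>_surj: "\<Phi> ` carrier grp = carrier (cyclic_product m k)"
proof
  show "\<Phi> ` carrier grp \<subseteq> carrier (cyclic_product m k)"
    using group_hom.hom_closed[OF \<Phi>_hom] by blast
  show "carrier (cyclic_product m k) \<subseteq> \<Phi> ` carrier grp"
  proof
    fix x assume x: "x \<in> carrier (cyclic_product m k)"
    define w where "w j = cis (2 * pi * of_int (x j) / of_nat (k j))" for j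
    have w: "w j ^ k j = 1" if "j < m" for j
    proof -
      have "w j ^ k j = cis (2 * pi * of_int (x j))"
        unfolding w_def DeMoivre using root_subgroup_a(1)[OF that] by simp
      then show ?thesis using cis_multiple_2pi[of "of_int (x j)"] by simp
    qed
    obtain g where g: "g \<in> G" "\<forall>j<m. orbit_char j g = w j" using orbit_char_surj[OF w] by blast
    have xj: "x j \<in> {0..<int (k j)}" if "j < m" for j
      using x that by (auto simp: carrier_cyclic_product PiE_iff)
    have "\<Phi> g = x"
    proof (rule extensionalityI[of _ "{..<m}"])
      show "\<Phi> g \<in> extensional {..<m}" by (simp add: \<Phi>_def)
      show "x \<in> extensional {..<m}" using x by (auto simp: carrier_cyclic_product PiE_iff)
      fix j assume "j \<in> {..<m}"
      then show "\<Phi> g j = x j"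
        using g(2) unity_log_eqI[OF root_subgroup_a(1) xj, of j "w j"] by (simp add: \<Phi>_def w_def)
    qed
    then show "x \<in> \<Phi> ` carrier grp" using g(1) by auto
  qed
qed

text \<open>The map of the first isomorphism theorem: \<open>\<Phi>\<close> is constant on each
  coset of its kernel, so the image of a coset is a singleton.\<close>

definition \<phi> :: "complex mat set \<Rightarrow> nat \<Rightarrow> int" where
  "\<phi> = (\<lambda>x. the_elem (\<Phi> ` x))"

lemma \<phi>_iso: "\<phi> \<in> iso ab (cyclic_product m k)"
  using group_hom.FactGroup_iso_set[OF \<Phi>_hom \<Phi>_surj]
  by (simp add: \<phi>_def abelianisation_def \<Phi>_kernel)

lemma \<phi>_ab_map:
  assumes g: "g \<in> G"
  shows "\<phi> (\<pi> g) = \<Phi> g"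
proof -
  interpret \<Phi>: group_hom grp "cyclic_product m k" \<Phi> by (rule \<Phi>_hom)
  have "\<Phi> x = \<Phi> g" if x: "x \<in> \<pi> g" for x
  proof -
    obtain h where h: "h \<in> derived grp G" "x = h \<otimes>\<^bsub>grp\<^esub> g"
      using x by (auto simp: abelianisation_map_def r_coset_def)
    then have "h \<in> carrier grp" "\<Phi> h = \<one>\<^bsub>cyclic_product m k\<^esub>"
      by (auto simp: kernel_def simp flip: \<Phi>_kernel)
    then show ?thesis
      using g h(2) \<Phi>.hom_mult[of h g] \<Phi>.hom_closed[of g] by (simp del: \<Phi>.hom_mult)
  qed
  moreover have "g \<in> \<pi> g"
    using group.rcos_self[OF group_grp, of g "derived grp G"] normal_imp_subgroup[OF derived_normal] g
    by (simp add: abelianisation_map_def)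
  ultimately have "\<Phi> ` \<pi> g = {\<Phi> g}" by blast
  then show ?thesis by (simp add: \<phi>_def)
qed

section \<open>Reflections under the abelianisation map\<close>

lemma reflection_cases:
  assumes "g \<in> G" "reflection d g"
  obtains b z i where "b \<in> roots d G" "z \<noteq> 1" "g = hrefl d b z" "i < m"
    "reflection_orbit d G b = reflection_orbit d G (a i)" "\<And>j. j < m \<Longrightarrow> orbit_char j g = (if j = i then z else 1)"
proof -
  obtain b z where b: "b \<in> roots d G" "z \<noteq> 1" "g = hrefl d b z"
    using reflection_in_G_iff[of g] assms by blast
  obtain i where i: "i < m" "reflection_orbit d G b = reflection_orbit d G (a i)"
    using orbit_cover[OF b(1)] by blast
  show thesis
    by (rule that[OF b i]) (use orbit_char_hrefl_in_orbit[OF i(1) _ b(1) _ i(2), of _ z] b assms(1) in auto)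
qed

lemma diagonal_action_\<Phi>:
  assumes g: "g \<in> G"
  shows "diagonal_action m k (\<Phi> g) = mat m m (\<lambda>(i, j). if i = j then orbit_char i g else 0)"
  unfolding diagonal_action_def
  by (rule cong_mat) (auto simp: \<Phi>_def unity_log(2)[OF root_subgroup_a(1) orbit_char_power[OF g]])

text \<open>A diagonal matrix with a single entry z besides ones is again an \<open>hrefl\<close>,
  with the i-th unit vector as root. Source and image therefore share the parameter z.\<close>

lemma diagonal_action_reflection:
  assumes g: "g \<in> G" and i: "i < m" and orbit_char: "\<And>j. j < m \<Longrightarrow> orbit_char j g = (if j = i then z else 1)"
  shows "diagonal_action m k (\<Phi> g) = hrefl m (unit_vec m i) z"
proof -
  have "unit_vec m i \<bullet>c unit_vec m i = (1 :: complex)"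
    using i by (simp add: conjugate_vec_def)
  then show ?thesis
    unfolding diagonal_action_\<Phi>[OF g] hrefl_def
    by (intro cong_mat) (use i in \<open>auto simp: orbit_char\<close>)
qed

text \<open>All three orders are the multiplicative order of z. In the quotient this holds because
  an element is trivial exactly when all its characters are 1, and the i-th character of a power of
  g is the same power of z.\<close>

lemma reflection_image:
  assumes g: "g \<in> G" and r: "reflection d g"
  shows "reflection m (diagonal_action m k (\<Phi> g))"
    and "group.ord (GL m) (diagonal_action m k (\<Phi> g)) = group.ord grp g"
    and "group.ord ab (\<pi> g) = group.ord grp g"
proof -
  obtain b z i where b: "b \<in> roots d G" and z: "z \<noteq> 1" and gb: "g = hrefl d b z" and i: "i < m"
    and orbit_char: "\<And>j. j < m \<Longrightarrow> orbit_char j g = (if j = i then z else 1)"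
    using reflection_cases[OF g r] by metis
  note bD = rootsD[OF b]
  have z0: "z \<noteq> 0" using hrefl_in_G_nonzero[OF bD] g gb by simp
  have e: "unit_vec m i \<in> carrier_vec m" "unit_vec m i \<noteq> (0\<^sub>v m :: complex vec)"
    using i by auto
  have D: "diagonal_action m k (\<Phi> g) = hrefl m (unit_vec m i) z"
    by (rule diagonal_action_reflection[OF g i orbit_char])
  show "reflection m (diagonal_action m k (\<Phi> g))"
    unfolding D by (rule reflection_hrefl[OF e z0 z])
  have pow: "g [^]\<^bsub>grp\<^esub> l = hrefl d b (z ^ l)" for l :: nat
    unfolding gb by (rule hrefl_pow[OF _ _ bD]) auto
  have pow_one: "g [^]\<^bsub>grp\<^esub> l = \<one>\<^bsub>grp\<^esub> \<longleftrightarrow> z ^ l = 1" for l :: nat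
    using hrefl_eq_iff[OF bD, of "z ^ l" 1] by (simp add: pow)
  show "group.ord (GL m) (diagonal_action m k (\<Phi> g)) = group.ord grp g"
  proof (rule ord_eqI[OF group_GL group_grp])
    show "diagonal_action m k (\<Phi> g) \<in> carrier (GL m)"
      using hrefl_in_GL_iff[OF e] z0 by (simp add: D)
    show "diagonal_action m k (\<Phi> g) [^]\<^bsub>GL m\<^esub> l = \<one>\<^bsub>GL m\<^esub> \<longleftrightarrow> g [^]\<^bsub>grp\<^esub> l = \<one>\<^bsub>grp\<^esub>" for l :: nat
      using hrefl_eq_iff[OF e, of "z ^ l" 1] unfolding pow_one D by (simp add: hrefl_pow[OF _ _ e])
  qed (use g in simp)
  show "group.ord ab (\<pi> g) = group.ord grp g"
  proof (rule ord_eqI[OF comm_group.axioms(2)[OF comm_group_ab] group_grp])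
    show "\<pi> g [^]\<^bsub>ab\<^esub> l = \<one>\<^bsub>ab\<^esub> \<longleftrightarrow> g [^]\<^bsub>grp\<^esub> l = \<one>\<^bsub>grp\<^esub>" for l :: nat
    proof -
      have gl: "g [^]\<^bsub>grp\<^esub> l \<in> G"
        using monoid.nat_pow_closed[OF group.is_monoid[OF group_grp], of g l] g by simp
      have "\<pi> g [^]\<^bsub>ab\<^esub> l = \<pi> (g [^]\<^bsub>grp\<^esub> l)"
        using group_hom.hom_nat_pow[OF ab_hom, of g l] g by simp
      then have "\<pi> g [^]\<^bsub>ab\<^esub> l = \<one>\<^bsub>ab\<^esub> \<longleftrightarrow> (\<forall>j<m. orbit_char j (g [^]\<^bsub>grp\<^esub> l) = 1)"
        using ab_map_eq_one_iff[OF gl] derived_iff_ch[OF gl] by simp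
      also have "\<dots> \<longleftrightarrow> (\<forall>j<m. orbit_char j g ^ l = 1)"
      proof -
        have "orbit_char j (g [^]\<^bsub>grp\<^esub> l) = orbit_char j g ^ l" if "j < m" for j
          using that monoid.nat_pow_closed[OF group.is_monoid[OF group_grp], of g] g
          by (induction l) (auto simp: orbit_char_mult)
        then show ?thesis by simp
      qed
      also have "\<dots> \<longleftrightarrow> z ^ l = 1" using i by (auto simp: orbit_char)
      finally show ?thesis by (simp only: pow_one)
    qed
  qed (use g in simp_all)
qed

text \<open>Each conjugate in the orbit consists of the reflections with one root b and all
  \<open>k j\<close>-th roots of unity z as parameters; the j-th coordinate is the logarithm of z
  and the others are 0. So every single conjugate already fills the summand.\<close>

lemma orbit_image:
  assumes j: "j < m" and H: "H \<in> reflection_orbit d G (a j)"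
  shows "\<Phi> ` H = cyclic_summand m k j"
proof -
  note kj = root_subgroup_a(1)[OF j]
  obtain g where g: "g \<in> G" and Hg: "H = root_subgroup d G (g *\<^sub>v a j)"
    using H reflection_orbit_eq[OF a_roots[OF j]] by auto
  define b where "b = g *\<^sub>v a j"
  have b: "b \<in> roots d G" "reflection_orbit d G b = reflection_orbit d G (a j)"
    using mult_vec_roots[OF g a_roots[OF j]] reflection_orbit_mult_vec[OF g a_roots[OF j]] by (simp_all add: b_def)
  have inG: "hrefl d b z \<in> G \<longleftrightarrow> z ^ k j = 1" for z
    using hrefl_conjugate[OF b(1) j b(2)] by metis
  have H_eq: "H = hrefl d b ` {z. z ^ k j = 1}"
    unfolding Hg root_subgroup_eq[OF rootsD[OF b(1)], unfolded b_def] using inG by (auto simp: b_def)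
  have val: "\<Phi> (hrefl d b z) = (\<lambda>i\<in>{..<m}. if i = j then unity_log (k j) z else 0)" if "z ^ k j = 1" for z
    unfolding \<Phi>_def using orbit_char_hrefl_in_orbit[OF j _ b(1) _ b(2), of _ z] inG that root_subgroup_a(1)
    by (intro restrict_ext) auto
  show ?thesis
  proof
    show "\<Phi> ` H \<subseteq> cyclic_summand m k j"
      using unity_log(1)[OF kj] root_subgroup_a(1) j
      by (auto simp: H_eq val cyclic_summand_def carrier_cyclic_product)
    show "cyclic_summand m k j \<subseteq> \<Phi> ` H"
    proof
      fix x assume "x \<in> cyclic_summand m k j"
      then have x: "x \<in> extensional {..<m}" "x j \<in> {0..<int (k j)}" "\<And>i. i < m \<Longrightarrow> i \<noteq> j \<Longrightarrow> x i = 0"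
        using j by (auto simp: cyclic_summand_def carrier_cyclic_product PiE_iff)
      define z where "z = cis (2 * pi * of_int (x j) / of_nat (k j))"
      have "z ^ k j = cis (2 * pi * of_int (x j))" unfolding z_def DeMoivre using kj by simp
      then have z: "z ^ k j = 1" using cis_multiple_2pi[of "of_int (x j)"] by simp
      have "\<Phi> (hrefl d b z) = x"
        unfolding val[OF z]
        by (rule extensionalityI[OF _ x(1)])
          (use x(3) unity_log_eqI[OF kj x(2)] in \<open>auto simp: z_def\<close>)
      then show "x \<in> \<Phi> ` H" using z by (auto simp: H_eq)
    qed
  qed
qed

text \<open>If the generators avoided orbit j, its character would be 1 on all of them and hence on
  G, contrary to its value z \<noteq> 1 on a reflection with root \<open>a j\<close>.\<close>

lemma orbit_contains_generator:
  assumes S: "S \<subseteq> {g \<in> G. reflection d g}" and gen: "generate grp S = G" and j: "j < m"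
  shows "\<exists>H\<in>reflection_orbit d G (a j). \<exists>s\<in>S. s \<in> H"
proof (rule ccontr)
  assume none: "\<not> ?thesis"
  have one: "orbit_char j s = 1" if s: "s \<in> S" for s
  proof -
    have sG: "s \<in> G" "reflection d s" using s S by auto
    obtain b z i where b: "b \<in> roots d G" "s = hrefl d b z"
      and i: "i < m" "reflection_orbit d G b = reflection_orbit d G (a i)"
      and orbit_char: "orbit_char j s = (if j = i then z else 1)"
      using reflection_cases[OF sG] j by metis
    have "s \<in> root_subgroup d G b" using root_subgroup_eq[OF rootsD[OF b(1)]] b(2) sG by blast
    then have "i \<noteq> j" using none s root_subgroup_in_orbit[OF b(1)] i(2) by auto
    then show ?thesis using orbit_char by simp
  qed
  have "g \<in> G \<and> orbit_char j g = 1" if "g \<in> generate grp S" for g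
    using that
  proof (induction)
    case (inv h)
    then have h: "h \<in> G" using S by auto
    then show ?case using orbit_char_inv[OF j h] one[OF inv] by (simp add: grp_inv)
  next
    case (incl h)
    then show ?case using one S by auto
  qed (use j in \<open>auto simp: orbit_char_mult\<close>)
  then have triv: "orbit_char j g = 1" if "g \<in> G" for g using that gen by blast
  obtain z where z: "z \<noteq> 1" "hrefl d (a j) z \<in> G" using a_roots[OF j] by (auto simp: roots_iff)
  then show False using triv[OF z(2)] orbit_char_hrefl[OF j a_roots[OF j] z(2)] by simp
qed

text \<open>The character of its own orbit takes the parameter z \<noteq> 1 on a reflection, whereas
  all characters are 1 on commutators.\<close>

lemma derived_no_reflection:
  assumes "g \<in> derived grp G"
  shows "\<not> reflection d g"
proof
  assume r: "reflection d g"
  have g: "g \<in> G" using assms subgroup.subset[OF normal_imp_subgroup[OF derived_normal]] by auto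
  obtain i z where "z \<noteq> 1" "i < m" "orbit_char i g = z"
    using reflection_cases[OF g r] by metis
  then show False using derived_iff_ch[OF g] assms by auto
qed

end

theorem lemma7p1:
  fixes d m :: nat
    and G :: "complex mat set"
    and a :: "nat \<Rightarrow> complex vec"
    and n k :: "nat \<Rightarrow> nat"
  assumes "complex_reflection_group d G"
    and "has_reflection_type d G m a n k"
  shows "(\<exists>\<phi> \<in> iso (abelianisation (as_group d G)) (cyclic_product m k).
            (\<forall>g\<in>G. reflection d g \<longrightarrow>
               reflection m (diagonal_action m k (\<phi> (abelianisation_map (as_group d G) g))) \<and>
               group.ord (GL m) (diagonal_action m k (\<phi> (abelianisation_map (as_group d G) g)))
                 = group.ord (as_group d G) g \<and>
               group.ord (abelianisation (as_group d G)) (abelianisation_map (as_group d G) g)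
                 = group.ord (as_group d G) g) \<and>
            (\<forall>j<m. \<forall>H \<in> reflection_orbit d G (a j).
               (\<phi> \<circ> abelianisation_map (as_group d G)) ` H = cyclic_summand m k j)) \<and>
         (\<forall>S \<subseteq> {g \<in> G. reflection d g}. generate (as_group d G) S = G \<longrightarrow>
            (\<forall>j<m. \<exists>H \<in> reflection_orbit d G (a j). \<exists>s\<in>S. s \<in> H)) \<and>
         derived (as_group d G) G \<lhd> as_group d G \<and>
         (\<forall>g \<in> derived (as_group d G) G. \<not> reflection d g)"
proof -
  obtain S where S: "S \<subseteq> Collect (reflection d)" "G = generate (GL d) S"
    using assms(1) by (auto simp: complex_reflection_group_def)
  then have "S \<subseteq> carrier (GL d)" by (auto simp: reflection_def)
  then have subgroup: "subgroup G (GL d)"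
    using group.generate_is_subgroup[OF group_GL] S(2) by simp
  then interpret reflection_group_type d G m a n k
    using assms(1)
    by (intro reflection_group_type.intro unitary_group.intro reflection_group_type_axioms.intro
        subgroup assms(2)) (auto simp: complex_reflection_group_def)
  \<comment> \<open>Needed because \<open>\<phi>_ab_map\<close> identifies
    \<open>\<phi> \<circ> \<pi>\<close> with \<open>\<Phi>\<close> for elements of G only.\<close>
  have sub: "H \<subseteq> G" if "j < m" "H \<in> reflection_orbit d G (a j)" for j H
    using that mult_vec_roots[OF _ a_roots]
    by (auto simp: reflection_orbit_eq[OF a_roots] root_subgroup_eq rootsD)
  have orb: "(\<phi> \<circ> \<pi>) ` H = cyclic_summand m k j" if "j < m" "H \<in> reflection_orbit d G (a j)" for j H
  proof -
    have "(\<phi> \<circ> \<pi>) ` H = \<Phi> ` H"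
      using sub[OF that] \<phi>_ab_map by (intro image_cong) auto
    then show ?thesis using orbit_image[OF that] by simp
  qed
  show ?thesis
    by (intro conjI bexI[OF _ \<phi>_iso] ballI allI impI orb derived_normal)
      (use reflection_image orbit_contains_generator derived_no_reflection in \<open>simp_all add: \<phi>_ab_map\<close>)
qed

end
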